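(* For every integer $n\geq 4$ there exists a non-diagonal critical central section of $Q_n$ whose normal vector has only non-zero coordinates. That is, there exists a unit vector $\mathbf{v}=(v_1,\ldots,v_n)\in S^{n-1}$ with $v_i\neq 0$ for all $i=1,\ldots,n$ such that $\mathbf{v}$ is a critical point of the restriction of $\sigma$ to $S^{n-1}$ and $\mathbf{v}$ is not a diagonal direction.
   Context: $Q_n = [-\frac12,\frac12]^n\subset\mathbb{R}^n$ is the centered unit cube. For a non-zero vector $\mathbf{v}\in\mathbb{R}^n$, the central section function is $\sigma(\mathbf{v}) = \mathrm{Vol}_{n-1}(Q_n\cap \mathbf{v}^\perp)$, the $(n-1)$-dimensional volume of the section of $Q_n$ by the linear hyperplane orthogonal to $\mathbf{v}$. $S^{n-1}$ is the Euclidean unit sphere in $\mathbb{R}^n$. A critical direction is a critical point of $\sigma$ on $S^{n-1}$ (the differential of $\sigma|_{S^{n-1}}$ vanishes there), and the corresponding central section $Q_n\cap\mathbf{v}^\perp$ is called critical. A direction (and the corresponding section) is called diagonal if it is $k$-diagonal for some $1\le k\le n$, i.e. its normal vector is parallel to the main diagonal of a $k$-dimensional face of $Q_n$; equivalently, up to permuting coordinates and changing signs of coordinates, the unit normal equals $\frac{1}{\sqrt k}(1,\ldots,1,0,\ldots,0)$ with $k$ ones and $n-k$ zeros. *)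

theory Defs
  imports "HOL-Analysis.Analysis"
begin

definition orthonormal_basis_of :: "'a::euclidean_space set \<Rightarrow> 'a set \<Rightarrow> bool" where
  "orthonormal_basis_of S B \<longleftrightarrow>
     B \<subseteq> S \<and> pairwise orthogonal B \<and> (\<forall>b\<in>B. norm b = 1) \<and> span B = S"

lemma orthonormal_basis_of_exists:
  assumes "subspace S"
  shows "\<exists>B. orthonormal_basis_of S B"
proof -
  obtain B where "B \<subseteq> S" "pairwise orthogonal B" "\<And>x. x \<in> B \<Longrightarrow> norm x = 1" "span B = S"
    using orthonormal_basis_subspace[OF assms] by metis
  then show ?thesis
    unfolding orthonormal_basis_of_def by blast
qed

text \<open>
  Lebesgue measure of dimension dim S on a linear subspace S, built from an orthonormal basis of S
  in the same way as lborel is built from the standard basis. Lebesgue measure is invariant under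
  linear isometries, so the choice of the basis is immaterial.
\<close>

definition subspace_lborel :: "'a::euclidean_space set \<Rightarrow> 'a measure" where
  "subspace_lborel S =
     (let B = (SOME B. orthonormal_basis_of S B)
      in distr (Pi\<^sub>M B (\<lambda>_. lborel)) borel (\<lambda>c. \<Sum>b\<in>B. c b *\<^sub>R b))"

definition unit_cube :: "(real ^ 'n) set" where
  "unit_cube = cbox (\<chi> i. - (1/2)) (\<chi> i. 1/2)"

definition orth_hyperplane :: "real ^ 'n \<Rightarrow> (real ^ 'n) set" where
  "orth_hyperplane v = {x. v \<bullet> x = 0}"

definition central_section :: "real ^ 'n \<Rightarrow> (real ^ 'n) set" where
  "central_section v = unit_cube \<inter> orth_hyperplane v"

text \<open>Meaningful for nonzero v only; for v = 0 the subspace is the whole space.\<close>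

definition section_volume :: "real ^ 'n \<Rightarrow> real" where
  "section_volume v = measure (subspace_lborel (orth_hyperplane v)) (central_section v)"

text \<open>
  A derivative within the sphere is determined only on the tangent space at v, which is the
  orthogonal complement of v. The differential of the restriction of f to the sphere is the
  restriction of D to that space; its value in the normal direction is irrelevant.
\<close>

definition critical_point_on_sphere :: "('a::euclidean_space \<Rightarrow> real) \<Rightarrow> 'a \<Rightarrow> bool" where
  "critical_point_on_sphere f v \<longleftrightarrow>
     v \<in> sphere 0 1 \<and>
     (\<exists>D. (f has_derivative D) (at v within sphere 0 1) \<and> (\<forall>w. v \<bullet> w = 0 \<longrightarrow> D w = 0))"

definition critical_direction :: "real ^ 'n \<Rightarrow> bool" where
  "critical_direction v \<longleftrightarrow> critical_point_on_sphere section_volume v"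

text \<open>
  The set I and the signs s encode the permutation of coordinates and the sign changes that take
  (1,\<dots>,1,0,\<dots>,0), with k ones, to a vector parallel to v, that is, to the main diagonal
  of a k-dimensional face of the cube with free coordinates I. Here sgn v is the unit normal
  v / norm v.
\<close>

definition k_diagonal :: "nat \<Rightarrow> real ^ 'n \<Rightarrow> bool" where
  "k_diagonal k v \<longleftrightarrow>
     (\<exists>(I :: 'n set) (s :: 'n \<Rightarrow> real). card I = k \<and> (\<forall>i. s i \<in> {-1, 1}) \<and>
        sgn v = (1 / sqrt (real k)) *\<^sub>R (\<chi> i. if i \<in> I then s i else 0))"

definition diagonal_direction :: "real ^ 'n \<Rightarrow> bool" where
  "diagonal_direction v \<longleftrightarrow> (\<exists>k. 1 \<le> k \<and> k \<le> CARD('n) \<and> k_diagonal k v)"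

end

theory Submission
  imports Defs "HOL-Probability.Probability"
begin

text \<open>
  Put \<open>m = n - 2\<close> and consider the directions \<open>(s, s, 1, \<dots>, 1)\<close>. As \<open>s\<close> grows, the section volume
  tends to the global maximum \<open>\<surd>2\<close> from below; at \<open>s = 1\<close>, the main diagonal, it has a strict local
  maximum. Hence some \<open>s > 1\<close> is critical for the profile in \<open>s\<close>, and by symmetry and homogeneity
  the whole differential of the section volume vanishes there.

  Strict local maximality at the main diagonal amounts to
  \<open>(m + 2) (m + 3) f\<^sub>m(1) < m (m - 1) f\<^sub>m(0)\<close>, where \<open>f\<^sub>m\<close> is the density of a sum of \<open>m\<close> independent
  uniform variables on \<open>[-1/2, 1/2]\<close>. It follows from the stronger family
  \<open>f\<^sub>m(r/2 + 1) \<phi>(m + r + 2) \<le> \<phi>(m - r) f\<^sub>m(r/2)\<close> for integers \<open>r \<ge> -1\<close> with \<open>\<phi>(p) = p\<^sup>3 - p\<close>,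
  which is stable under the B-spline recursion because
  \<open>p \<phi>(q) + q \<phi>(p)\<close> decreases when \<open>(p, q)\<close> is replaced by \<open>(p - 2, q + 2)\<close>.
\<close>

subsection \<open>Central differences and B-splines\<close>

text \<open>The two equal coordinates make the profile explicit: integrating them out leaves a
  second difference of absolute values, so the volume in direction (s, s, 1, ..., 1) is \<open>sqrt
  (2 * s\<^sup>2 + real m) * (mean_abs m s - mean_abs m 0) / s\<^sup>2\<close>. The cubic comes from
  the target inequality: \<phi>(m + 2) = (m + 1) (m + 2) (m + 3) and \<phi>(m) = (m - 1) m (m + 1),
  so the member r = 0 of the family is the target times m + 1. The other members are carried along
  because the recursion shifts arguments by 1/2 and thus links r to r - 1 and r + 1. The family
  contains equalities; strictness comes from the defect in the last exchange. The section volume is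
  built from an unspecified orthonormal basis of a hyperplane that moves with the direction. Hence a
  formula in standard coordinates, valid on a whole neighbourhood of the critical direction, has to
  precede any differentiation.\<close>

primrec central_diff :: "nat \<Rightarrow> (real \<Rightarrow> real) \<Rightarrow> real \<Rightarrow> real" where
  "central_diff 0 g = g"
| "central_diff (Suc m) g = (\<lambda>x. central_diff m g (x + 1/2) - central_diff m g (x - 1/2))"

text \<open>For positive \<open>k\<close> this is twice the truncated power of order
  \<open>k\<close> minus the polynomial x^k / k!, which differences of order above \<open>k\<close>
  annihilate. Unlike the truncated power it has a parity, and for \<open>k = 1\<close> it is the
  absolute value.\<close>

definition spow :: "nat \<Rightarrow> real \<Rightarrow> real" where
  "spow k x = sgn x * x ^ k / fact k"

text \<open>Leibniz rule with a linear factor. One difference of x g(x) is x times the difference of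
  g plus the average of the two shifted values; averaging commutes with differencing, so each
  further difference adds one more such average. The B-spline recursion and the identities for
  \<open>mean_abs\<close> all come from this rule.\<close>

lemma central_diff_mult_ident:
  "central_diff (Suc m) (\<lambda>x. x * g x) x =
     x * central_diff (Suc m) g x
     + (real m + 1) / 2 * (central_diff m g (x + 1/2) + central_diff m g (x - 1/2))"
proof (induction m arbitrary: x)
  case 0
  show ?case by (simp add: field_simps)
next
  case (Suc m)
  have split: "central_diff (Suc (Suc m)) h y
      = central_diff (Suc m) h (y + 1/2) - central_diff (Suc m) h (y - 1/2)"
    "central_diff (Suc m) h (y + 1/2) = central_diff m h (y + 1) - central_diff m h y"
    "central_diff (Suc m) h (y - 1/2) = central_diff m h y - central_diff m h (y - 1)" for h y
    by (simp_all add: add.commute)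
  have shift: "x + 1/2 + 1/2 = x + 1" "x + 1/2 - 1/2 = x" "x - 1/2 + 1/2 = x" "x - 1/2 - 1/2 = x - 1"
    by simp_all
  show ?case
    unfolding split(1) Suc.IH shift unfolding split(2,3) of_nat_Suc
    by (simp add: distrib_left distrib_right left_diff_distrib right_diff_distrib add_divide_distrib)
qed

lemma central_diff_cmult: "central_diff m (\<lambda>x. c * g x) x = c * central_diff m g x"
  by (induction m arbitrary: x) (auto simp: algebra_simps)

lemma central_diff_has_real_derivative:
  assumes "\<And>x. (G has_real_derivative g x) (at x)"
  shows "(central_diff m G has_real_derivative central_diff m g x) (at x)"
proof (induction m arbitrary: x)
  case 0
  show ?case using assms by simp
next
  case (Suc m)
  show ?case
    unfolding central_diff.simps
    by (intro DERIV_diff DERIV_chain'[OF _ Suc.IH, of _ 1 , simplified])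
       (auto intro!: derivative_eq_intros)
qed

lemma continuous_on_central_diff:
  assumes "continuous_on UNIV g"
  shows "continuous_on UNIV (central_diff m g)"
proof (induction m)
  case (Suc m)
  have "continuous_on UNIV (\<lambda>x. central_diff m g (x + c))" for c
    by (rule continuous_on_compose2[OF Suc]) (auto intro: continuous_intros)
  from this[of "1/2"] this[of "-1/2"] show ?case
    by (auto intro!: continuous_on_diff)
qed (simp add: assms)

lemma central_diff_minus:
  assumes "\<And>x. g (- x) = c * g x"
  shows "central_diff m g (- x) = (-1) ^ m * c * central_diff m g x"
proof (induction m arbitrary: x)
  case 0
  show ?case using assms by simp
next
  case (Suc m)
  have "central_diff (Suc m) g (- x) = central_diff m g (- (x - 1/2)) - central_diff m g (- (x + 1/2))"
    by (simp add: algebra_simps)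
  also have "\<dots> = (-1) ^ Suc m * c * central_diff (Suc m) g x"
    unfolding Suc.IH by (simp add: algebra_simps)
  finally show ?case .
qed

lemma spow_minus: "spow k (- x) = (-1) ^ Suc k * spow k x"
  by (simp add: spow_def sgn_minus power_minus[of x])

lemma spow_1: "spow (Suc 0) x = \<bar>x\<bar>"
  by (simp add: spow_def abs_sgn mult.commute)

lemma ident_times_spow: "x * spow k x = (real k + 1) * spow (Suc k) x"
  by (simp add: spow_def divide_simps)

lemma spow_has_real_derivative:
  assumes "0 < k"
  shows "(spow (Suc k) has_real_derivative spow k x) (at x)"
proof -
  have deriv: "((\<lambda>x. x ^ Suc k / fact (Suc k)) has_real_derivative x ^ k / fact k) (at x)" for x :: real
  proof -
    have "((\<lambda>x. x ^ Suc k / fact (Suc k)) has_real_derivative real (Suc k) * x ^ k / fact (Suc k)) (at x)"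
      by (rule DERIV_cdivide) (rule DERIV_cong[OF DERIV_pow], simp)
    also have "real (Suc k) * x ^ k / fact (Suc k) = x ^ k / fact k"
      unfolding fact_Suc by (simp del: of_nat_Suc)
    finally show ?thesis .
  qed
  consider "x > 0" | "x < 0" | "x = 0" by linarith
  then show ?thesis
  proof cases
    case 1
    have "((\<lambda>x. x ^ Suc k / fact (Suc k)) has_real_derivative spow k x) (at x)"
      using deriv[of x] 1 by (simp add: spow_def)
    moreover have "\<forall>\<^sub>F y in nhds x. spow (Suc k) y = y ^ Suc k / fact (Suc k)"
      using eventually_nhds_in_open[of "{0<..}" x] 1
      by (auto elim!: eventually_mono simp: spow_def)
    ultimately show ?thesis
      by (simp add: DERIV_cong_ev[OF refl _ refl])
  next
    case 2
    have "((\<lambda>x. - (x ^ Suc k / fact (Suc k))) has_real_derivative spow k x) (at x)"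
      using DERIV_minus[OF deriv[of x]] 2 by (simp add: spow_def)
    moreover have "\<forall>\<^sub>F y in nhds x. spow (Suc k) y = - (y ^ Suc k / fact (Suc k))"
      using eventually_nhds_in_open[of "{..<0}" x] 2
      by (auto elim!: eventually_mono simp: spow_def)
    ultimately show ?thesis
      by (simp add: DERIV_cong_ev[OF refl _ refl])
  next
    case 3
    \<comment> \<open>The monomial formulas only cover the two open half-lines. At the origin the
      difference quotient is \<open>spow k h / (real k + 1)\<close>, which tends to 0 because
      \<open>k\<close> is positive.\<close>
    have "((\<lambda>h. spow k h / (real k + 1)) \<longlongrightarrow> 0) (at 0)"
    proof (rule Lim_null_comparison)
      show "\<forall>\<^sub>F h in at 0. norm (spow k h / (real k + 1)) \<le> \<bar>h\<bar> ^ k"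
      proof (intro always_eventually allI)
        fix h :: real
        have "norm (spow k h / (real k + 1)) = \<bar>sgn h\<bar> * \<bar>h\<bar> ^ k / (fact k * (real k + 1))"
          by (simp add: spow_def abs_mult power_abs)
        also have "\<dots> \<le> \<bar>h\<bar> ^ k / 1"
          using mult_mono[of 1 "fact k" 1 "real k + 1"]
          by (intro frac_le) (auto simp: sgn_if)
        finally show "norm (spow k h / (real k + 1)) \<le> \<bar>h\<bar> ^ k" by simp
      qed
      show "((\<lambda>h::real. \<bar>h\<bar> ^ k) \<longlongrightarrow> 0) (at 0)"
        using assms by (auto intro!: tendsto_eq_intros)
    qed
    moreover have "\<forall>\<^sub>F h in at 0. spow k h / (real k + 1) = (spow (Suc k) (0 + h) - spow (Suc k) 0) / h"
      unfolding eventually_at_filter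
      by (intro always_eventually) (auto simp: spow_def divide_simps)
    ultimately have "((\<lambda>h. (spow (Suc k) (0 + h) - spow (Suc k) 0) / h) \<longlongrightarrow> 0) (at 0)"
      by (rule Lim_transform_eventually)
    then show ?thesis
      using 3 assms by (simp add: DERIV_def spow_def)
  qed
qed

lemma continuous_on_spow:
  assumes "0 < k"
  shows "continuous_on S (spow k)"
proof (cases "k = 1")
  case True
  have "spow k = (\<lambda>x. \<bar>x\<bar>)" using True by (simp add: fun_eq_iff spow_1)
  then show ?thesis by (simp add: continuous_on_rabs)
next
  case False
  with assms obtain l where l: "k = Suc l" "0 < l" by (cases k) auto
  have "\<forall>x\<in>S. isCont (spow k) x"
    unfolding l(1) using DERIV_isCont[OF spow_has_real_derivative[OF l(2)]] by blast
  then show ?thesis by (rule continuous_at_imp_continuous_on)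
qed

text \<open>The density of the overview; the factor 1/2 undoes the doubling in \<open>spow\<close>.
  The exponent \<open>m - 1\<close> makes sense for positive \<open>m\<close>, and the inductions
  start at \<open>m = 2\<close>, where the function is continuous.\<close>

definition bspline :: "nat \<Rightarrow> real \<Rightarrow> real" where
  "bspline m x = central_diff m (spow (m - 1)) x / 2"

text \<open>\<open>spow (Suc m)\<close> is an m-fold antiderivative of the absolute value, and a
  central difference of an antiderivative is an average over a unit interval. So this is the
  expectation of the absolute value of x plus m independent uniform variables.\<close>

definition mean_abs :: "nat \<Rightarrow> real \<Rightarrow> real" where
  "mean_abs m = central_diff m (spow (Suc m))"

lemma central_diff_spow_Suc:
  "(real k + 1) * central_diff (Suc m) (spow (Suc k)) x =
     x * central_diff (Suc m) (spow k) x
     + (real m + 1) / 2 * (central_diff m (spow k) (x + 1/2) + central_diff m (spow k) (x - 1/2))"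
  using central_diff_mult_ident[of m "spow k" x] unfolding ident_times_spow by (simp only: central_diff_cmult)

text \<open>The Cox-de Boor recursion for cardinal B-splines, centred. The weights are the distances
  from x to the ends of the support, hence nonnegative there.\<close>

lemma bspline_Suc:
  assumes "0 < m"
  shows "real m * bspline (Suc m) x =
    ((real m + 1) / 2 + x) * bspline m (x + 1/2) + ((real m + 1) / 2 - x) * bspline m (x - 1/2)"
proof -
  obtain k where k: "m = Suc k" using assms by (cases m) auto
  have *: "real m * central_diff (Suc m) (spow m) x =
     x * central_diff (Suc m) (spow k) x
     + (real m + 1) / 2 * (central_diff m (spow k) (x + 1/2) + central_diff m (spow k) (x - 1/2))"
    using central_diff_spow_Suc[of k m x] unfolding k by (simp only: of_nat_Suc add.commute)
  have "central_diff (Suc m) (spow k) x = central_diff m (spow k) (x + 1/2) - central_diff m (spow k) (x - 1/2)"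
    by simp
  with * show ?thesis
    unfolding bspline_def diff_Suc_1 k
    by (simp only: distrib_left distrib_right left_diff_distrib right_diff_distrib add_divide_distrib
        diff_divide_distrib times_divide_eq_right times_divide_eq_left)
qed

section \<open>Symmetry, support and sign of the B-splines\<close>

lemma bspline_2: "bspline 2 x = (\<bar>x + 1\<bar> + \<bar>x - 1\<bar>) / 2 - \<bar>x\<bar>"
  by (simp add: bspline_def numeral_2_eq_2 spow_1)

lemma bspline_minus: "0 < m \<Longrightarrow> bspline m (- x) = bspline m x"
  unfolding bspline_def
  by (subst central_diff_minus[where g = "spow (m - 1)", OF spow_minus]) (simp flip: power_add)

lemma bspline_eq_0:
  assumes "2 \<le> m" "real m / 2 \<le> \<bar>x\<bar>"
  shows "bspline m x = 0"
  using assms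
proof (induction m arbitrary: x rule: nat_induct_at_least)
  case base
  then show ?case by (simp add: bspline_2)
next
  case (Suc m)
  have *: "bspline (Suc m) x = 0" if "real (Suc m) / 2 \<le> x" for x
  proof -
    have 1: "bspline m (x + 1/2) = 0"
      using that by (intro Suc.IH) (auto simp: field_simps)
    have 2: "((real m + 1) / 2 - x) * bspline m (x - 1/2) = 0"
    proof (cases "x = (real m + 1) / 2")
      case False
      with that have "bspline m (x - 1/2) = 0" by (intro Suc.IH) (auto simp: field_simps)
      then show ?thesis by simp
    qed simp
    have "real m * bspline (Suc m) x = 0"
      using bspline_Suc[of m x] Suc.hyps unfolding 1 2 by simp
    then show ?thesis using Suc.hyps by simp
  qed
  show ?case
    using *[of x] *[of "-x"] bspline_minus[of "Suc m" x] Suc.prems by (cases "x \<ge> 0") auto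
qed

lemma bspline_nonneg: "2 \<le> m \<Longrightarrow> 0 \<le> bspline m x"
proof (induction m arbitrary: x rule: nat_induct_at_least)
  case base
  then show ?case by (simp add: bspline_2)
next
  case (Suc m)
  show ?case
  proof (cases "real (Suc m) / 2 \<le> \<bar>x\<bar>")
    case False
    then have "\<bar>x\<bar> < (real m + 1) / 2" by simp
    then have "0 \<le> (real m + 1) / 2 + x" "0 \<le> (real m + 1) / 2 - x" by linarith+
    then have "0 \<le> real m * bspline (Suc m) x"
      unfolding bspline_Suc[OF order.strict_trans2[OF pos2 Suc.hyps]]
      using add_nonneg_nonneg[OF mult_nonneg_nonneg mult_nonneg_nonneg] Suc.IH by blast
    then show ?thesis using Suc.hyps by (simp add: zero_le_mult_iff)
  qed (use Suc.hyps in \<open>simp add: bspline_eq_0\<close>)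
qed

text \<open>The half-step of the recursion computes the value at 0 from the one at 1/2 and
  conversely, so both points have to be carried through the induction.\<close>

lemma bspline_pos: "2 \<le> m \<Longrightarrow> 0 < bspline m 0 \<and> 0 < bspline m (1/2)"
proof (induction m rule: nat_induct_at_least)
  case base
  then show ?case by (simp add: bspline_2)
next
  case (Suc m)
  have "real m * bspline (Suc m) 0 = (real m + 1) * bspline m (1/2)"
    using bspline_Suc[of m 0] bspline_minus[of m "1/2"] Suc.hyps by simp
  moreover have "real m * bspline (Suc m) (1/2) = (real m + 2) / 2 * bspline m 1 + real m / 2 * bspline m 0"
    using bspline_Suc[of m "1/2"] Suc.hyps by (simp add: add_divide_distrib)
  moreover have "0 \<le> bspline m 1"
    using Suc.hyps by (rule bspline_nonneg)
  ultimately have "0 < real m * bspline (Suc m) 0" "0 < real m * bspline (Suc m) (1/2)"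
    using Suc by (auto intro!: add_nonneg_pos)
  then show ?case by (simp add: zero_less_mult_iff)
qed

section \<open>The ratio inequality on the half-integer grid\<close>

text \<open>With \<phi>(p) = p^3 - p, the left side is 2 (M^4 - M^2 - r^4 + r^2), and the exchange
  replaces r by r + 2; the defect therefore does not depend on M. It is kept exactly because it
  later supplies strictness.\<close>

lemma cubic_exchange:
  fixes r M :: real
  defines "p \<equiv> M - r" and "q \<equiv> M + r"
  shows "q * (p^3 - p) + p * (q^3 - q)
    = (q + 2) * ((p - 2)^3 - (p - 2)) + (p - 2) * ((q + 2)^3 - (q + 2)) + 8 * (r + 1) * (2 * r^2 + 4 * r + 3)"
  unfolding p_def q_def by (simp add: power2_eq_square power3_eq_cube algebra_simps)

text \<open>The cubic is negative strictly between 0 and 1; integrality of r keeps m - r out of that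
  gap.\<close>

lemma cube_diff_nonneg: "0 \<le> (x::real)^3 - x" if "1 \<le> x \<or> x = 0"
  using that power_increasing[of 1 3 x] by auto

text \<open>The recursion weights at the two points of level \<open>Suc m\<close> are the halves of
  q + 2, p - 2 and of q, p, and only three values of level \<open>m\<close> occur. The hypotheses
  are the ratio inequality at r - 1 and r + 1; they compare the outer two values with the middle
  one, and the remaining comparison of coefficients is \<open>cubic_exchange\<close>. The factor
  \<open>real m\<close> stays so that the recursion applies without division.\<close>

lemma bspline_step:
  assumes m: "2 \<le> m" and r: "0 \<le> r" "r \<le> int (Suc m) - 2"
  defines "p \<equiv> real (Suc m) - of_int r" and "q \<equiv> real (Suc m) + of_int r"
  assumes IH1: "bspline m (of_int r / 2 + 1/2) * (q^3 - q) \<le> (p^3 - p) * bspline m (of_int r / 2 - 1/2)"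
    and IH2: "bspline m (of_int r / 2 + 3/2) * ((q + 2)^3 - (q + 2)) \<le> ((p - 2)^3 - (p - 2)) * bspline m (of_int r / 2 + 1/2)"
  shows "real m * (bspline (Suc m) (of_int r / 2 + 1) * ((q + 2)^3 - (q + 2)))
     \<le> real m * ((p^3 - p) * bspline (Suc m) (of_int r / 2))
       - 4 * (of_int r + 1) * (2 * (of_int r)^2 + 4 * of_int r + 3) * bspline m (of_int r / 2 + 1/2)"
proof -
  define C0 C1 C2 where "C0 = bspline m (of_int r / 2 - 1/2)" and "C1 = bspline m (of_int r / 2 + 1/2)"
    and "C2 = bspline m (of_int r / 2 + 3/2)"
  have p: "2 \<le> p" and q: "0 \<le> q"
    using r by (auto simp: p_def q_def)
  have l: "real m * bspline (Suc m) (of_int r / 2 + 1) = ((q + 2) * C2 + (p - 2) * C1) / 2"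
    using bspline_Suc[of m "of_int r / 2 + 1"] m
    unfolding C1_def C2_def p_def q_def
    by (simp add: add.assoc) (simp add: field_simps)
  have u: "real m * bspline (Suc m) (of_int r / 2) = (q * C1 + p * C0) / 2"
    using bspline_Suc[of m "of_int r / 2"] m
    unfolding C0_def C1_def p_def q_def by (simp add: field_simps)
  define a b c d e where "a = (q + 2)^3 - (q + 2)" and "b = (p - 2)^3 - (p - 2)" and "c = p^3 - p"
    and "d = q^3 - q" and "e = (of_int r + 1) * (2 * (of_int r)^2 + 4 * of_int r + (3::real))"
  note abcde = a_def[symmetric] b_def[symmetric] c_def[symmetric] d_def[symmetric]
  have 1: "(q + 2) * (C2 * a) \<le> (q + 2) * (b * C1)"
    using IH2 q unfolding C1_def C2_def abcde by (intro mult_left_mono) auto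
  have 2: "p * (C1 * d) \<le> p * (c * C0)"
    using IH1 p unfolding C0_def C1_def abcde by (intro mult_left_mono) auto
  have 3: "(q * c + p * d) * C1 = ((q + 2) * b + (p - 2) * a + 8 * e) * C1"
    using cubic_exchange[where M = "real (Suc m)" and r = "of_int r"]
    unfolding a_def b_def c_def d_def e_def p_def q_def by simp
  have "((q + 2) * C2 + (p - 2) * C1) * a \<le> c * (q * C1 + p * C0) - 8 * e * C1"
    using 1 2 3 by (simp add: algebra_simps)
  then have "((q + 2) * C2 + (p - 2) * C1) / 2 * a \<le> c * ((q * C1 + p * C0) / 2) - 4 * e * C1"
    by simp
  then show ?thesis
    unfolding abcde C1_def[symmetric] l[symmetric] u[symmetric]
    unfolding e_def by (simp only: mult_ac)
qed

text \<open>The step at r consumes both neighbours, so all grid points are treated at once. At r =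
  -1 the two sides coincide by evenness. At the right end the B-spline on the left is evaluated
  outside its support, and m - r is 0 or 1, a root of the cubic.\<close>

lemma bspline_ratio_le:
  assumes "2 \<le> m" "-1 \<le> r" "r \<le> int m"
  shows "bspline m (of_int r / 2 + 1) * ((real m + of_int r + 2)^3 - (real m + of_int r + 2))
    \<le> ((real m - of_int r)^3 - (real m - of_int r)) * bspline m (of_int r / 2)"
  using assms
proof (induction m arbitrary: r rule: nat_induct_at_least)
  case base
  consider "r = -1" | "0 \<le> r" using base by linarith
  then show ?case
  proof cases
    case 1
    then show ?thesis using bspline_minus[of 2 "1/2"] by simp
  next
    case 2
    then have "bspline 2 (of_int r / 2 + 1) = 0" by (intro bspline_eq_0) auto
    moreover have "0 \<le> (real 2 - of_int r)^3 - (real 2 - of_int r)"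
      using base 2 by (intro cube_diff_nonneg) (auto simp: le_less)
    ultimately show ?thesis using bspline_nonneg[of 2 "of_int r / 2"] by simp
  qed
next
  case (Suc m)
  consider "r = -1" | "0 \<le> r" "r \<le> int (Suc m) - 2" | "int (Suc m) - 1 \<le> r" using Suc.prems by linarith
  then show ?case
  proof cases
    case 1
    then show ?thesis using bspline_minus[of "Suc m" "1/2"] by (simp add: add.commute)
  next
    case 2
    define E where "E = 4 * (of_int r + 1) * (2 * (of_int r)^2 + 4 * of_int r + 3) * bspline m (of_int r / 2 + 1/2)"
    have "0 \<le> E"
      unfolding E_def using 2 Suc.hyps by (intro mult_nonneg_nonneg bspline_nonneg) auto
    have i: "of_int (r - 1) / 2 = of_int r / 2 - (1/2 :: real)" "of_int r / 2 - 1/2 + 1 = of_int r / 2 + (1/2 :: real)"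
      "of_int (r + 1) / 2 = of_int r / 2 + (1/2 :: real)" "of_int r / 2 + 1/2 + 1 = of_int r / 2 + (3/2 :: real)"
      "real m + of_int (r - 1) + 2 = real (Suc m) + of_int r" "real m - of_int (r - 1) = real (Suc m) - of_int r"
      "real m + of_int (r + 1) + 2 = real (Suc m) + of_int r + 2" "real m - of_int (r + 1) = real (Suc m) - of_int r - 2"
      by (auto simp: field_simps)
    have "real m * (bspline (Suc m) (of_int r / 2 + 1) * ((real (Suc m) + of_int r + 2)^3 - (real (Suc m) + of_int r + 2)))
     \<le> real m * (((real (Suc m) - of_int r)^3 - (real (Suc m) - of_int r)) * bspline (Suc m) (of_int r / 2)) - E"
      unfolding E_def
      by (rule bspline_step[OF Suc.hyps 2 Suc.IH[of "r - 1", unfolded i] Suc.IH[of "r + 1", unfolded i]])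
         (use 2 in auto)
    with \<open>0 \<le> E\<close> have "real m * (bspline (Suc m) (of_int r / 2 + 1) * ((real (Suc m) + of_int r + 2)^3 - (real (Suc m) + of_int r + 2)))
     \<le> real m * (((real (Suc m) - of_int r)^3 - (real (Suc m) - of_int r)) * bspline (Suc m) (of_int r / 2))"
      by linarith
    then show ?thesis
      by (rule mult_left_le_imp_le) (use Suc.hyps in simp)
  next
    case 3
    then have "bspline (Suc m) (of_int r / 2 + 1) = 0"
      using Suc.hyps by (intro bspline_eq_0) (auto simp: field_simps)
    moreover have "real (Suc m) - of_int r = 1 \<or> real (Suc m) - of_int r = 0"
    proof -
      have "int (Suc m) - r = 1 \<or> int (Suc m) - r = 0" using 3 Suc.prems by linarith
      then have "of_int (int (Suc m) - r) = (1::real) \<or> of_int (int (Suc m) - r) = (0::real)" by auto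
      then show ?thesis by simp
    qed
    ultimately show ?thesis by auto
  qed
qed

text \<open>The member r = 0, with the common factor m + 1 cancelled. For \<open>m > 2\<close>
  strictness is the defect of the last recursion step, 12 times a positive B-spline value at 1/2;
  for \<open>m = 2\<close> the B-spline vanishes at 1.\<close>

lemma bspline_ratio_less:
  assumes "2 \<le> m"
  shows "(real m + 2) * (real m + 3) * bspline m 1 < real m * (real m - 1) * bspline m 0"
proof (cases "m = 2")
  case True
  then show ?thesis by (simp add: bspline_2)
next
  case False
  then obtain k where k: "m = Suc k" "2 \<le> k" using assms by (cases m) auto
  have "real k * (bspline m 1 * ((real m + 2)^3 - (real m + 2)))
     \<le> real k * (((real m)^3 - real m) * bspline m 0) - 12 * bspline k (1/2)"
    using bspline_step[of k 0] bspline_ratio_le[of k "-1"] bspline_ratio_le[of k 1] k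
    by (simp add: algebra_simps)
  also have "\<dots> < real k * (((real m)^3 - real m) * bspline m 0)"
    using bspline_pos[of k] k by simp
  finally have "bspline m 1 * ((real m + 2)^3 - (real m + 2)) < ((real m)^3 - real m) * bspline m 0"
    using k by (simp add: mult_less_cancel_left_pos)
  also have "bspline m 1 * ((real m + 2)^3 - (real m + 2)) = (real m + 1) * ((real m + 2) * (real m + 3) * bspline m 1)"
    by (simp add: power3_eq_cube algebra_simps)
  also have "((real m)^3 - real m) * bspline m 0 = (real m + 1) * (real m * (real m - 1) * bspline m 0)"
    by (simp add: power3_eq_cube algebra_simps)
  finally show ?thesis by (simp add: mult_less_cancel_left_pos)
qed

subsection \<open>The critical equation\<close>

lemma spow_continuous_UNIV: "0 < k \<Longrightarrow> continuous_on UNIV (central_diff m (spow k))"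
  by (intro continuous_on_central_diff continuous_on_spow)

section \<open>Calculus of the mean absolute value\<close>

lemma mean_abs_has_real_derivative:
  "0 < m \<Longrightarrow> (mean_abs m has_real_derivative central_diff m (spow m) x) (at x)"
  unfolding mean_abs_def by (intro central_diff_has_real_derivative spow_has_real_derivative)

lemma mean_abs_has_real_derivative2:
  assumes "2 \<le> m"
  shows "(central_diff m (spow m) has_real_derivative 2 * bspline m x) (at x)"
proof -
  obtain k where "m = Suc k" "0 < k" using assms by (cases m) auto
  then show ?thesis
    using central_diff_has_real_derivative[of "spow m" "spow k" m x] spow_has_real_derivative
    by (simp add: bspline_def del: central_diff.simps)
qed

lemma mean_abs_minus: "mean_abs m (- x) = mean_abs m x"
  unfolding mean_abs_def
  by (subst central_diff_minus[where g = "spow (Suc m)", OF spow_minus]) (simp flip: power_add)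

lemma mean_abs_0: "mean_abs 0 x = \<bar>x\<bar>"
  by (simp add: mean_abs_def spow_1)

lemma mean_abs_Suc: "((\<lambda>t. mean_abs m (c + t)) has_integral mean_abs (Suc m) c) {-1/2..1/2}"
proof -
  have "((\<lambda>t. mean_abs m (c + t)) has_integral
      (central_diff m (spow (Suc (Suc m))) (c + 1/2) - central_diff m (spow (Suc (Suc m))) (c + (-1/2)))) {-1/2..1/2}"
  proof (rule fundamental_theorem_of_calculus)
    fix t :: real
    have "(central_diff m (spow (Suc (Suc m))) has_real_derivative mean_abs m (c + t)) (at (c + t))"
      unfolding mean_abs_def by (intro central_diff_has_real_derivative spow_has_real_derivative) auto
    from DERIV_shift[THEN iffD1, OF this[unfolded add.commute[of c]]]
    have "((\<lambda>x. central_diff m (spow (Suc (Suc m))) (c + x)) has_real_derivative mean_abs m (c + t)) (at t)"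
      by (simp add: add.commute)
    then show "((\<lambda>x. central_diff m (spow (Suc (Suc m))) (c + x)) has_vector_derivative mean_abs m (c + t))
        (at t within {-1/2..1/2})"
      by (simp add: has_real_derivative_iff_has_vector_derivative has_vector_derivative_at_within)
  qed simp
  then show ?thesis by (simp add: mean_abs_def)
qed

lemma continuous_on_mean_abs: "continuous_on S (mean_abs m)"
  using spow_continuous_UNIV[of "Suc m" m] continuous_on_subset unfolding mean_abs_def by blast

text \<open>Jensen's inequality for a centred perturbation, one uniform summand at a time.\<close>

lemma mean_abs_ge: "\<bar>c\<bar> \<le> mean_abs m c"
proof (induction m arbitrary: c)
  case (Suc m)
  have "((\<lambda>t. c + t) has_integral (c * (1/2 - (-1/2)) + ((1/2)\<^sup>2 / 2 - (-1/2)\<^sup>2 / 2))) {-1/2..1/2}" for c :: real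
    using has_integral_add[OF has_integral_const_real[of c "-1/2" "1/2"] ident_has_integral[of "-1/2" "1/2"]]
    by simp
  then have int: "((\<lambda>t. c + t) has_integral c) {-1/2..1/2}" for c :: real by (simp add: power2_eq_square)
  have *: "c \<le> mean_abs (Suc m) c" for c
    by (rule has_integral_le[OF int mean_abs_Suc]) (use Suc abs_le_D1 in blast)
  from *[of c] *[of "-c"] show ?case by (simp add: mean_abs_minus abs_le_iff)
qed (simp add: mean_abs_0)

text \<open>A single summand is enough: averaging the bound of \<open>mean_abs_ge\<close> over the
  last variable gives at least \<open>mean_abs 1 0\<close>, which is 1/4.\<close>

lemma mean_abs_pos: "0 < m \<Longrightarrow> 0 < mean_abs m 0"
proof (cases m)
  case (Suc k)
  have "((\<lambda>t::real. \<bar>t\<bar>) has_integral mean_abs 1 0) {-1/2..1/2}"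
    using mean_abs_Suc[of 0 0] by (simp add: mean_abs_0)
  moreover have "((\<lambda>t. mean_abs k t) has_integral mean_abs (Suc k) 0) {-1/2..1/2}"
    using mean_abs_Suc[of k 0] by simp
  ultimately have "mean_abs 1 0 \<le> mean_abs (Suc k) 0"
    by (rule has_integral_le) (rule mean_abs_ge)
  then show ?thesis using Suc by (simp add: mean_abs_def spow_def power2_eq_square)
qed simp

text \<open>Beyond m / 2 the perturbed argument cannot change sign, and the perturbation has mean
  zero.\<close>

lemma mean_abs_eq: "real m / 2 \<le> x \<Longrightarrow> mean_abs m x = x"
proof (induction m arbitrary: x)
  case (Suc m)
  have "((\<lambda>t. x + t) has_integral x) {-1/2..1/2}"
    using has_integral_add[OF has_integral_const_real[of x "-1/2" "1/2"] ident_has_integral[of "-1/2" "1/2"]]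
    by (simp add: power2_eq_square)
  moreover have "((\<lambda>t. x + t) has_integral mean_abs (Suc m) x) {-1/2..1/2}"
    by (rule has_integral_eq[OF _ mean_abs_Suc]) (use Suc in \<open>auto simp: field_simps\<close>)
  ultimately show ?case using has_integral_unique by blast
qed (simp add: mean_abs_0)

lemma mean_abs_deriv_eq_1:
  assumes "0 < m" "real m / 2 < x"
  shows "central_diff m (spow m) x = 1"
proof (rule DERIV_unique)
  have "\<forall>\<^sub>F y in nhds x. mean_abs m y = y"
    using eventually_nhds_in_open[of "{real m / 2<..}" x] assms
    by (auto elim!: eventually_mono intro!: mean_abs_eq)
  then show "(mean_abs m has_real_derivative 1) (at x)"
    by (subst DERIV_cong_ev[OF refl _ refl, where g = "\<lambda>x. x"]) auto
qed (use assms mean_abs_has_real_derivative in blast)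

text \<open>Up to a positive factor, the derivative in \<open>s\<close> of the section volume in direction
  \<open>(s, s, 1, \<dots>, 1)\<close>.\<close>

definition crit_eq :: "nat \<Rightarrow> real \<Rightarrow> real" where
  "crit_eq m s = s * (2 * s\<^sup>2 + real m) * central_diff m (spow m) s
     - 2 * (s\<^sup>2 + real m) * (mean_abs m s - mean_abs m 0)"

text \<open>This is \<open>crit_eq m 1 = 0\<close>: the main diagonal is critical. The Leibniz rule
  at 1 and at 0 expresses both sides by differences of order m - 1 at 1/2 and 3/2, once evenness has
  removed the point -1/2.\<close>

lemma mean_abs_diff_1:
  "0 < m \<Longrightarrow> 2 * (real m + 1) * (mean_abs m 1 - mean_abs m 0) = (real m + 2) * central_diff m (spow m) 1"
proof (cases m)
  case (Suc k)
  have *: "(real m + 1) * mean_abs m x = x * central_diff m (spow m) x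
     + real m / 2 * (central_diff k (spow m) (x + 1/2) + central_diff k (spow m) (x - 1/2))" for x
    using central_diff_spow_Suc[of m k x] unfolding Suc mean_abs_def by (simp only: of_nat_Suc add.commute)
  have even: "central_diff k (spow m) (- (1/2)) = central_diff k (spow m) (1/2)"
    unfolding Suc by (subst central_diff_minus[where g = "spow (Suc k)", OF spow_minus]) (simp flip: power_add)
  have "central_diff m (spow m) 1 = central_diff k (spow m) (1 + 1/2) - central_diff k (spow m) (1/2)"
    unfolding Suc by simp
  moreover have "2 * (real m + 1) * (mean_abs m 1 - mean_abs m 0)
      = 2 * ((real m + 1) * mean_abs m 1) - 2 * ((real m + 1) * mean_abs m 0)"
    by (simp add: algebra_simps)
  moreover have "real m * central_diff m (spow m) 1
      = real m * (central_diff k (spow m) (1 + 1/2) - central_diff k (spow m) (1/2))"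
    unfolding Suc by simp
  ultimately show ?thesis
    unfolding * using even by (simp add: algebra_simps del: central_diff.simps)
qed simp

text \<open>The derivative of \<open>mean_abs m\<close> is odd, so its value at 1 is its difference
  across a unit step centred at 1/2, that is, \<open>2 * bspline (Suc m) (1/2)\<close>; one
  recursion step returns to level m.\<close>

lemma mean_abs_deriv_1:
  assumes "2 \<le> m"
  shows "2 * real m * central_diff m (spow m) 1 = 2 * (real m + 2) * bspline m 1 + 2 * real m * bspline m 0"
proof -
  have "central_diff m (spow m) (- 0) = - central_diff m (spow m) 0"
    by (subst central_diff_minus[where g = "spow m", OF spow_minus]) (simp flip: power_add)
  then have "central_diff m (spow m) 1 = central_diff (Suc m) (spow m) (1/2)" by simp
  then have "central_diff m (spow m) 1 = 2 * bspline (Suc m) (1/2)"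
    by (simp add: bspline_def del: central_diff.simps)
  moreover have "real m * bspline (Suc m) (1/2) = (real m + 2) / 2 * bspline m 1 + real m / 2 * bspline m 0"
    using bspline_Suc[of m "1/2"] assms by (simp add: add_divide_distrib)
  moreover have "2 * real m * (2 * bspline (Suc m) (1/2)) = 4 * (real m * bspline (Suc m) (1/2))"
    by simp
  ultimately show ?thesis
    by (simp add: distrib_right)
qed

text \<open>The target inequality originates here. Multiplying the derivative by m + 1 allows the
  elimination of the \<open>mean_abs\<close> difference and then of the first derivative; what is
  left is exactly the difference of the two sides of \<open>bspline_ratio_less\<close>.\<close>

lemma crit_eq_deriv_1:
  assumes "2 \<le> m"
  obtains d where "(crit_eq m has_real_derivative d) (at 1)" "d < 0"
proof
  define A B where "A = central_diff m (spow m) 1" and "B = mean_abs m 1 - mean_abs m 0"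
  show "(crit_eq m has_real_derivative
     ((6 + real m) * A + (2 + real m) * (2 * bspline m 1) - (4 * B + 2 * (1 + real m) * A))) (at 1)"
    unfolding crit_eq_def A_def B_def
    using assms
    by (auto intro!: derivative_eq_intros mean_abs_has_real_derivative mean_abs_has_real_derivative2
        simp: algebra_simps)
  have "(real m + 1) * ((6 + real m) * A + (2 + real m) * (2 * bspline m 1) - (4 * B + 2 * (1 + real m) * A))
    = (real m + 1) * (6 + real m) * A + (real m + 1) * (2 + real m) * (2 * bspline m 1)
      - 2 * (2 * (real m + 1) * B) - 2 * (real m + 1) * (1 + real m) * A"
    by (simp add: algebra_simps)
  also have "\<dots> = 2 * (real m + 1) * (2 + real m) * bspline m 1 - (real m - 1) * (real m * A)"
    using mean_abs_diff_1[of m] assms unfolding A_def[symmetric] B_def[symmetric]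
    by (simp add: algebra_simps)
  also have "real m * A = (real m + 2) * bspline m 1 + real m * bspline m 0"
    using mean_abs_deriv_1[OF assms] unfolding A_def[symmetric] by (simp add: algebra_simps)
  also have "2 * (real m + 1) * (2 + real m) * bspline m 1
      - (real m - 1) * ((real m + 2) * bspline m 1 + real m * bspline m 0)
    = (real m + 2) * (real m + 3) * bspline m 1 - real m * (real m - 1) * bspline m 0"
    by (simp add: algebra_simps)
  also have "\<dots> < 0" using bspline_ratio_less[OF assms] by simp
  finally show "(6 + real m) * A + (2 + real m) * (2 * bspline m 1) - (4 * B + 2 * (1 + real m) * A) < 0"
    by (simp add: mult_less_0_iff)
qed

lemma crit_eq_root:
  assumes "2 \<le> m"
  obtains s where "1 < s" "crit_eq m s = 0"
proof -
  have "crit_eq m 1 = 0"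
    using mean_abs_diff_1[of m] assms by (simp add: crit_eq_def algebra_simps)
  moreover obtain d where "(crit_eq m has_real_derivative d) (at 1)" "d < 0"
    using crit_eq_deriv_1[OF assms] .
  ultimately obtain e where e: "0 < e" "crit_eq m (1 + e) < 0"
    using DERIV_neg_dec_right[of "crit_eq m" d 1] by (metis dense)
  define K where "K = mean_abs m 0"
  have "0 < K" unfolding K_def using assms by (intro mean_abs_pos) auto
  \<comment> \<open>For t > m / 2 the mean absolute value is t itself, and
    \<open>crit_eq m t\<close> becomes t (2 t K - m) + 2 m K. Positivity of K decides the sign, and
    t is taken large enough to give t > m / 2, t K > m and t \<ge> 1 + e.\<close>
  define t where "t = 1 + e + real m + real m / K"
  have "0 \<le> real m / K" using \<open>0 < K\<close> by simp
  moreover have "t * K = (1 + e + real m) * K + real m"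
    using \<open>0 < K\<close> by (simp add: t_def distrib_right)
  moreover have "0 < (1 + e + real m) * K" using e \<open>0 < K\<close> by simp
  ultimately have t: "real m / 2 < t" "1 + e \<le> t" "real m < t * K"
    using e unfolding t_def by linarith+
  have "0 < t * (2 * (t * K) - real m) + 2 * real m * K"
    using t e \<open>0 < K\<close> by (intro add_nonneg_pos mult_nonneg_nonneg) (use assms in auto)
  also have "\<dots> = crit_eq m t"
    using t mean_abs_deriv_eq_1[of m t] mean_abs_eq[of m t] assms
    by (simp add: crit_eq_def K_def power2_eq_square algebra_simps)
  finally have "0 < crit_eq m t" .
  moreover have "continuous_on {1 + e..t} (crit_eq m)"
    unfolding crit_eq_def using assms
    by (intro continuous_intros continuous_on_mean_abs continuous_on_subset[OF spow_continuous_UNIV]) auto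
  ultimately obtain s where "1 + e \<le> s" "crit_eq m s = 0"
    using IVT'[of "crit_eq m" "1 + e" 0 t] e t by auto
  then show ?thesis using that[of s] e by simp
qed

subsection \<open>Lebesgue measure in orthonormal coordinates\<close>

text \<open>The uniqueness argument for Haar measure: f(x + y) g(y) is integrated in both orders.
  Translating x gives the left side; translating y turns the second factor into g(y - x), and
  evenness with invariance of M gives the right side.\<close>

lemma translation_invariant_nn_integral_times:
  fixes M N :: "'a::euclidean_space measure" and f g :: "'a \<Rightarrow> ennreal"
  assumes "sigma_finite_measure M" "sigma_finite_measure N"
    and [measurable_cong]: "sets M = sets borel" "sets N = sets borel"
    and M: "\<And>a. distr M borel (\<lambda>x. x + a) = M"
    and N: "\<And>a. distr N borel (\<lambda>x. x + a) = N"
    and [measurable]: "f \<in> borel_measurable borel" "g \<in> borel_measurable borel"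
    and even: "\<And>x. g (- x) = g x"
  shows "(\<integral>\<^sup>+x. f x \<partial>M) * (\<integral>\<^sup>+x. g x \<partial>N) = (\<integral>\<^sup>+x. f x \<partial>N) * (\<integral>\<^sup>+x. g x \<partial>M)"
proof -
  interpret M: sigma_finite_measure M by fact
  interpret N: sigma_finite_measure N by fact
  interpret P: pair_sigma_finite M N ..
  have shiftM: "(\<integral>\<^sup>+x. h (x + a) \<partial>M) = (\<integral>\<^sup>+x. h x \<partial>M)"
    if [measurable]: "h \<in> borel_measurable borel" for h a
    by (subst (2) M[of a, symmetric]) (simp add: nn_integral_distr)
  have shiftN: "(\<integral>\<^sup>+x. h (x + a) \<partial>N) = (\<integral>\<^sup>+x. h x \<partial>N)"
    if [measurable]: "h \<in> borel_measurable borel" for h a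
    by (subst (2) N[of a, symmetric]) (simp add: nn_integral_distr)
  have "(\<integral>\<^sup>+x. f x \<partial>M) * (\<integral>\<^sup>+x. g x \<partial>N) = (\<integral>\<^sup>+y. (\<integral>\<^sup>+x. f (x + y) \<partial>M) * g y \<partial>N)"
    by (simp add: nn_integral_cmult shiftM)
  also have "\<dots> = (\<integral>\<^sup>+y. (\<integral>\<^sup>+x. f (x + y) * g y \<partial>M) \<partial>N)"
    by (simp add: nn_integral_multc)
  also have "\<dots> = (\<integral>\<^sup>+x. (\<integral>\<^sup>+y. f (x + y) * g y \<partial>N) \<partial>M)"
    by (rule P.Fubini') measurable
  also have "\<dots> = (\<integral>\<^sup>+x. (\<integral>\<^sup>+y. f y * g (y - x) \<partial>N) \<partial>M)"
  proof (rule nn_integral_cong)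
    fix x
    show "(\<integral>\<^sup>+y. f (x + y) * g y \<partial>N) = (\<integral>\<^sup>+y. f y * g (y - x) \<partial>N)"
      using shiftN[of "\<lambda>y. f y * g (y - x)" x] by (simp add: add.commute)
  qed
  also have "\<dots> = (\<integral>\<^sup>+y. (\<integral>\<^sup>+x. f y * g (y - x) \<partial>M) \<partial>N)"
    by (rule P.Fubini'[symmetric]) measurable
  also have "\<dots> = (\<integral>\<^sup>+y. f y * (\<integral>\<^sup>+x. g (x + (- y)) \<partial>M) \<partial>N)"
  proof -
    have "g (y - x) = g (x + (- y))" for x y
      using even[of "y - x"] by simp
    then show ?thesis by (simp add: nn_integral_cmult)
  qed
  also have "\<dots> = (\<integral>\<^sup>+x. f x \<partial>N) * (\<integral>\<^sup>+x. g x \<partial>M)"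
    using shiftM[of g "- y" for y] by (simp add: nn_integral_multc)
  finally show ?thesis .
qed

lemma distr_PiM_lborel_translate:
  fixes t :: "'i \<Rightarrow> 'a::euclidean_space"
  assumes "finite I"
  shows "distr (PiM I (\<lambda>_. lborel)) (PiM I (\<lambda>_. lborel)) (\<lambda>c. \<lambda>i\<in>I. c i + t i) = PiM I (\<lambda>_. lborel)"
proof -
  interpret product_sigma_finite "\<lambda>_::'i. lborel :: 'a measure"
    by standard
  show ?thesis
  proof (rule PiM_eqI)
    fix A :: "'i \<Rightarrow> 'a set"
    assume A: "\<And>i. i \<in> I \<Longrightarrow> A i \<in> sets lborel"
    have "(\<lambda>c. \<lambda>i\<in>I. c i + t i) -` (Pi\<^sub>E I A) \<inter> space (PiM I (\<lambda>_. lborel)) = Pi\<^sub>E I (\<lambda>i. (\<lambda>x. x + t i) -` A i)"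
      by (auto simp: space_PiM PiE_iff)
    moreover have "emeasure lborel ((\<lambda>x. x + t i) -` A i) = emeasure lborel (A i)" if "i \<in> I" for i
      using A[OF that] by (subst (2) lborel_distr_plus[of "t i", symmetric]) (simp add: emeasure_distr add.commute[of _ "t i"])
    moreover have "(\<lambda>x. x + t i) -` A i \<in> sets lborel" if "i \<in> I" for i
      using measurable_sets_borel[of "\<lambda>x. x + t i" borel "A i"] A[OF that] by simp
    ultimately show "emeasure (distr (PiM I (\<lambda>_. lborel)) (PiM I (\<lambda>_. lborel)) (\<lambda>c. \<lambda>i\<in>I. c i + t i)) (Pi\<^sub>E I A)
      = (\<Prod>i\<in>I. emeasure lborel (A i))"
      using A assms by (subst emeasure_distr) (auto simp: emeasure_PiM intro!: prod.cong sets_PiM_I_finite)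
  qed (use assms in auto)
qed

lemma nn_integral_gaussian:
  "0 < (\<integral>\<^sup>+x. ennreal (exp (- (x::real)\<^sup>2)) \<partial>lborel)" "(\<integral>\<^sup>+x. ennreal (exp (- (x::real)\<^sup>2)) \<partial>lborel) < \<infinity>"
proof -
  have "has_bochner_integral lborel (\<lambda>x::real. exp (- x\<^sup>2)) (2 *\<^sub>R (sqrt pi / 2))"
    by (rule has_bochner_integral_even_function[OF gaussian_moment_0]) simp
  then have "(\<integral>\<^sup>+x. ennreal (exp (- (x::real)\<^sup>2)) \<partial>lborel) = ennreal (2 *\<^sub>R (sqrt pi / 2))"
    by (intro nn_integral_eq_integral[THEN trans]) (auto simp: has_bochner_integral_iff)
  then show "0 < (\<integral>\<^sup>+x. ennreal (exp (- (x::real)\<^sup>2)) \<partial>lborel)" "(\<integral>\<^sup>+x. ennreal (exp (- (x::real)\<^sup>2)) \<partial>lborel) < \<infinity>"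
    by auto
qed

text \<open>Both sides are translation invariant, so they are proportional; integrating the radial product
  function \<open>exp (- (norm x)\<^sup>2)\<close> shows that the factor is one.\<close>

lemma distr_PiM_orthonormal:
  fixes e :: "'i \<Rightarrow> 'a::euclidean_space"
  assumes I: "finite I" "card I = DIM('a)"
    and orth: "\<And>i j. i \<in> I \<Longrightarrow> j \<in> I \<Longrightarrow> e i \<bullet> e j = (if i = j then 1 else 0)"
    and expand: "\<And>x. (\<Sum>i\<in>I. (x \<bullet> e i) *\<^sub>R e i) = x"
  shows "distr (PiM I (\<lambda>_. lborel)) borel (\<lambda>c. \<Sum>i\<in>I. c i *\<^sub>R e i) = lborel"
proof -
  interpret product_sigma_finite "\<lambda>_::'i. lborel :: real measure" by standard
  let ?P = "PiM I (\<lambda>_. lborel :: real measure)"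
  let ?T = "\<lambda>c. \<Sum>i\<in>I. c i *\<^sub>R e i"
  let ?G = "\<integral>\<^sup>+x. ennreal (exp (- (x::real)\<^sup>2)) \<partial>lborel"
  define M where "M = distr ?P borel ?T"
  have [measurable]: "?T \<in> measurable ?P borel"
    by measurable
  have [simp, measurable_cong]: "sets M = sets borel" by (simp add: M_def)
  have coord: "?T c \<bullet> e i = c i" if "i \<in> I" for c i
  proof -
    have "?T c \<bullet> e i = (\<Sum>j\<in>I. c j * (if j = i then 1 else 0))"
      unfolding inner_sum_left using orth that by (intro sum.cong) auto
    also have "\<dots> = c i" using I that by (simp add: if_distrib sum.delta cong: if_cong)
    finally show ?thesis .
  qed
  have norm2: "(norm (?T c))\<^sup>2 = (\<Sum>i\<in>I. (c i)\<^sup>2)" for c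
  proof -
    have "(norm (?T c))\<^sup>2 = ?T c \<bullet> (\<Sum>i\<in>I. c i *\<^sub>R e i)" by (simp add: power2_norm_eq_inner)
    also have "\<dots> = (\<Sum>i\<in>I. c i * (?T c \<bullet> e i))" unfolding inner_sum_right by simp
    also have "\<dots> = (\<Sum>i\<in>I. (c i)\<^sup>2)" by (intro sum.cong) (simp_all add: coord power2_eq_square)
    finally show ?thesis .
  qed
  have gaussM: "(\<integral>\<^sup>+x. ennreal (exp (- (norm x)\<^sup>2)) \<partial>M) = ?G ^ DIM('a)"
  proof -
    have "(\<integral>\<^sup>+x. ennreal (exp (- (norm x)\<^sup>2)) \<partial>M) = (\<integral>\<^sup>+c. (\<Prod>i\<in>I. ennreal (exp (- (c i)\<^sup>2))) \<partial>?P)"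
      unfolding M_def using I
      by (simp add: nn_integral_distr norm2 sum_negf[symmetric] exp_sum prod_ennreal)
    also have "\<dots> = ?G ^ DIM('a)"
      using I by (subst product_nn_integral_prod) auto
    finally show ?thesis .
  qed
  have gaussL: "(\<integral>\<^sup>+x. ennreal (exp (- (norm (x::'a))\<^sup>2)) \<partial>lborel) = ?G ^ DIM('a)"
  proof -
    have "(\<integral>\<^sup>+x. ennreal (exp (- (norm (x::'a))\<^sup>2)) \<partial>lborel) = (\<integral>\<^sup>+x. (\<Prod>b\<in>Basis. ennreal (exp (- ((x::'a) \<bullet> b)\<^sup>2))) \<partial>lborel)"
    proof (intro nn_integral_cong)
      fix x :: 'a
      have "(norm x)\<^sup>2 = (\<Sum>b\<in>Basis. (x \<bullet> b)\<^sup>2)"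
        unfolding power2_norm_eq_inner by (subst euclidean_inner) (simp add: power2_eq_square)
      then show "ennreal (exp (- (norm x)\<^sup>2)) = (\<Prod>b\<in>Basis. ennreal (exp (- (x \<bullet> b)\<^sup>2)))"
        by (simp add: sum_negf[symmetric] exp_sum prod_ennreal)
    qed
    also have "\<dots> = ?G ^ DIM('a)"
      by (subst nn_integral_lborel_prod) auto
    finally show ?thesis .
  qed
  have transM: "distr M borel (\<lambda>x. x + a) = M" for a
  proof -
    have "distr M borel (\<lambda>x. x + a) = distr ?P borel (\<lambda>c. ?T (\<lambda>i\<in>I. c i + a \<bullet> e i))"
      unfolding M_def
      by (subst distr_distr)
         (auto intro!: distr_cong simp: scaleR_add_left sum.distrib expand)
    also have "\<dots> = distr (distr ?P ?P (\<lambda>c. \<lambda>i\<in>I. c i + a \<bullet> e i)) borel ?T"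
      by (subst distr_distr) (auto simp: comp_def)
    also have "\<dots> = M"
      unfolding M_def distr_PiM_lborel_translate[OF I(1)] ..
    finally show ?thesis .
  qed
  have sigma: "sigma_finite_measure M"
  proof
    \<comment> \<open>Coordinates are bounded by the norm, so the preimage of a ball lies in a box
      of finite product measure.\<close>
    have fin: "emeasure M (cball 0 r) \<noteq> \<infinity>" for r
    proof -
      have "emeasure M (cball 0 r) = emeasure ?P (?T -` cball 0 r \<inter> space ?P)"
        unfolding M_def by (subst emeasure_distr) auto
      also have "\<dots> \<le> emeasure ?P (Pi\<^sub>E I (\<lambda>_. {-r..r}))"
      proof (rule emeasure_mono)
        show "?T -` cball 0 r \<inter> space ?P \<subseteq> Pi\<^sub>E I (\<lambda>_. {-r..r})"
        proof
          fix c assume c: "c \<in> ?T -` cball 0 r \<inter> space ?P"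
          have "\<bar>c i\<bar> \<le> r" if "i \<in> I" for i
          proof -
            have "norm (e i) = 1" using orth[OF that that] by (simp add: norm_eq_sqrt_inner)
            then have "\<bar>c i\<bar> \<le> norm (?T c)"
              using Cauchy_Schwarz_ineq2[of "?T c" "e i"] coord[OF that] by simp
            also have "\<dots> \<le> r" using c by simp
            finally show ?thesis .
          qed
          then have "c i \<in> {-r..r}" if "i \<in> I" for i using that by (simp add: abs_le_iff minus_le_iff)
          then show "c \<in> Pi\<^sub>E I (\<lambda>_. {-r..r})" using c by (auto simp: space_PiM PiE_iff)
        qed
      qed (use I in \<open>auto intro!: sets_PiM_I_finite\<close>)
      also have "\<dots> < \<infinity>"
        using I by (subst emeasure_PiM) (auto simp: emeasure_lborel_Icc_eq power_less_top_ennreal)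
      finally show ?thesis by simp
    qed
    have "(\<Union>n::nat. cball (0::'a) (real n)) = UNIV"
      using real_arch_simple by (auto simp: dist_norm)
    then show "\<exists>A. countable A \<and> A \<subseteq> sets M \<and> \<Union>A = space M \<and> (\<forall>a\<in>A. emeasure M a \<noteq> \<infinity>)"
      using fin by (intro exI[of _ "range (\<lambda>n::nat. cball 0 (real n))"]) (auto simp: M_def)
  qed
  have "emeasure M A = emeasure lborel A" if A: "A \<in> sets M" for A
  proof -
    have "(\<integral>\<^sup>+x. indicator A x \<partial>M) * (\<integral>\<^sup>+x. ennreal (exp (- (norm (x::'a))\<^sup>2)) \<partial>lborel)
        = (\<integral>\<^sup>+x. indicator A x \<partial>lborel) * (\<integral>\<^sup>+x. ennreal (exp (- (norm x)\<^sup>2)) \<partial>M)"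
    proof (rule translation_invariant_nn_integral_times[OF sigma sigma_finite_lborel])
      show "distr lborel borel (\<lambda>x. x + a) = lborel" for a :: 'a
        using lborel_distr_plus[of a] by (simp add: add.commute[of _ a])
    qed (use A transM in auto)
    then have "emeasure M A * ?G ^ DIM('a) / ?G ^ DIM('a) = emeasure lborel A * ?G ^ DIM('a) / ?G ^ DIM('a)"
      using A unfolding gaussM gaussL by simp
    moreover have "?G ^ DIM('a) \<noteq> 0" "?G ^ DIM('a) \<noteq> top"
      using nn_integral_gaussian by (auto simp: power_eq_top_ennreal)
    ultimately show ?thesis
      by (simp add: ennreal_mult_divide_eq)
  qed
  then show ?thesis
    unfolding M_def[symmetric] by (intro measure_eqI) auto
qed

subsection \<open>The section volume as an integral\<close>

lemma unit_cube_iff: "x \<in> unit_cube \<longleftrightarrow> (\<forall>i. \<bar>x $ i\<bar> \<le> 1/2)"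
proof -
  have "\<bar>y\<bar> \<le> 1/2 \<longleftrightarrow> - (1/2) \<le> y \<and> y \<le> 1/2" for y :: real by linarith
  then show ?thesis by (simp add: unit_cube_def mem_box_cart)
qed

text \<open>Whichever basis is selected by \<open>SOME\<close>, adjoining v gives an orthonormal
  basis of the whole space; this links the measure on the hyperplane to
  \<open>lborel\<close>.\<close>

lemma orthonormal_basis_of_orth_hyperplane:
  fixes v :: "real ^ 'n"
  assumes v: "norm v = 1" and B: "orthonormal_basis_of (orth_hyperplane v) B"
  shows "finite B" "v \<notin> B" "card (insert v B) = CARD('n)"
    "\<And>b c. b \<in> insert v B \<Longrightarrow> c \<in> insert v B \<Longrightarrow> b \<bullet> c = (if b = c then 1 else 0)"
    "\<And>x. (\<Sum>b\<in>insert v B. (x \<bullet> b) *\<^sub>R b) = x"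
    "\<And>x. v \<bullet> x = 0 \<Longrightarrow> (\<Sum>b\<in>B. (x \<bullet> b) *\<^sub>R b) = x"
    "\<And>b. b \<in> B \<Longrightarrow> v \<bullet> b = 0"
proof -
  let ?O = "insert v B"
  have B': "B \<subseteq> orth_hyperplane v" "pairwise orthogonal B" "\<And>b. b \<in> B \<Longrightarrow> norm b = 1" "span B = orth_hyperplane v"
    using B by (auto simp: orthonormal_basis_of_def)
  show vB: "v \<bullet> b = 0" if "b \<in> B" for b using B'(1) that by (auto simp: orth_hyperplane_def)
  have vv: "v \<bullet> v = 1" using v by (simp add: norm_eq_1)
  show "v \<notin> B" using vB vv by force
  have n1: "norm b = 1" if "b \<in> ?O" for b using v B'(3) that by auto
  have orth: "pairwise orthogonal ?O"
    using B'(2) vB by (auto simp: pairwise_insert orthogonal_def inner_commute)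
  have "0 \<notin> ?O" using n1 by force
  then have ind: "independent ?O" using orth by (rule pairwise_orthogonal_independent[rotated])
  then show finB: "finite B" using independent_imp_finite[of ?O] by simp
  have span: "span ?O = UNIV"
  proof (intro equalityI subsetI UNIV_I)
    fix x :: "real ^ 'n"
    have "x - (v \<bullet> x) *\<^sub>R v \<in> span B"
      unfolding B'(4) orth_hyperplane_def by (simp add: inner_diff_right vv)
    then show "x \<in> span ?O" by (subst span_insert) auto
  qed
  show "card ?O = CARD('n)"
    using basis_card_eq_dim[of ?O UNIV] ind span by (simp add: dim_UNIV)
  show "b \<bullet> c = (if b = c then 1 else 0)" if "b \<in> ?O" "c \<in> ?O" for b c
    using orth n1 that by (auto simp: pairwise_def orthogonal_def norm_eq_1)
  show "(\<Sum>b\<in>?O. (x \<bullet> b) *\<^sub>R b) = x" for x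
    using orthonormal_basis_expand[OF orth, of x] n1 span finB by auto
  show "(\<Sum>b\<in>B. (x \<bullet> b) *\<^sub>R b) = x" if "v \<bullet> x = 0" for x
    using orthonormal_basis_expand[OF B'(2,3), of x] that finB B'(4) by (auto simp: orth_hyperplane_def)
qed

text \<open>The section is the base of a prism with edges parallel to the \<open>j\<close>-th axis; it is described
  by two linear conditions that can be integrated both in a basis adapted to \<open>v\<close> and in standard
  coordinates.\<close>

definition section_prism :: "real ^ 'n \<Rightarrow> 'n \<Rightarrow> (real ^ 'n) set" where
  "section_prism v j = {x. \<bar>v \<bullet> x\<bar> \<le> 1/2 \<and> x - ((v \<bullet> x) / v $ j) *\<^sub>R axis j 1 \<in> unit_cube}"

lemma borel_unit_cube [measurable]: "unit_cube \<in> sets borel"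
  unfolding unit_cube_def by simp

lemma borel_section_prism [measurable]: "section_prism v j \<in> sets borel"
proof -
  have "closed (section_prism v j)"
  proof -
    have "closed ((\<lambda>x. x - ((v \<bullet> x) / v $ j) *\<^sub>R axis j 1) -` unit_cube)"
      unfolding unit_cube_def divide_inverse by (intro closed_vimage closed_cbox continuous_intros)
    moreover have "closed {x. \<bar>v \<bullet> x\<bar> \<le> 1/2}"
      by (intro closed_Collect_le continuous_intros)
    moreover have "section_prism v j = {x. \<bar>v \<bullet> x\<bar> \<le> 1/2} \<inter> (\<lambda>x. x - ((v \<bullet> x) / v $ j) *\<^sub>R axis j 1) -` unit_cube"
      by (auto simp: section_prism_def)
    ultimately show ?thesis by (simp only: closed_Int)
  qed
  then show ?thesis by (rule borel_closed)
qed

text \<open>In a basis adapted to v, the slice of the prism at height y is a translate of the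
  section within the hyperplane, and the heights fill an interval of length 1. Cavalieri's principle
  gives equality.\<close>

lemma emeasure_section_prism:
  fixes v :: "real ^ 'n"
  assumes v: "norm v = 1" and j: "v $ j \<noteq> 0"
  shows "emeasure (subspace_lborel (orth_hyperplane v)) (central_section v) = emeasure lborel (section_prism v j)"
proof -
  interpret product_sigma_finite "\<lambda>_::real ^ 'n. lborel :: real measure" by standard
  define B where "B = (SOME B. orthonormal_basis_of (orth_hyperplane v) B)"
  have "subspace (orth_hyperplane v)"
    by (auto simp: orth_hyperplane_def subspace_def inner_add_right)
  then have "orthonormal_basis_of (orth_hyperplane v) B"
    unfolding B_def by (rule someI_ex[OF orthonormal_basis_of_exists])
  note O = orthonormal_basis_of_orth_hyperplane[OF v this]
  have vv: "v \<bullet> v = 1" using v by (simp add: norm_eq_1)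
  let ?P = "PiM B (\<lambda>_. lborel :: real measure)"
  let ?Q = "PiM (insert v B) (\<lambda>_. lborel :: real measure)"
  let ?T = "\<lambda>c. \<Sum>b\<in>B. c b *\<^sub>R b"
  let ?T' = "\<lambda>c. \<Sum>b\<in>insert v B. c b *\<^sub>R b"
  have [measurable]: "?T \<in> measurable ?P borel" "?T' \<in> measurable ?Q borel" by measurable
  define H where "H = emeasure ?P (?T -` unit_cube \<inter> space ?P)"
  have [measurable]: "central_section v \<in> sets borel"
    unfolding central_section_def orth_hyperplane_def
    by (intro sets.Int borel_unit_cube borel_closed closed_hyperplane)
  have vT: "v \<bullet> ?T c = 0" for c using O(7) by (simp add: inner_sum_right)
  have "emeasure (subspace_lborel (orth_hyperplane v)) (central_section v) = emeasure ?P (?T -` central_section v \<inter> space ?P)"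
    unfolding subspace_lborel_def Let_def B_def[symmetric] by (subst emeasure_distr) auto
  also have "?T -` central_section v = ?T -` unit_cube"
    using vT by (auto simp: central_section_def orth_hyperplane_def)
  finally have lhs: "emeasure (subspace_lborel (orth_hyperplane v)) (central_section v) = H"
    unfolding H_def .
  have lborel: "lborel = distr ?Q borel ?T'"
    using O(1,3,4,5) by (intro distr_PiM_orthonormal[symmetric]) auto
  have "emeasure lborel (section_prism v j) = (\<integral>\<^sup>+x. indicator (section_prism v j) x \<partial>lborel)"
    by simp
  also have "\<dots> = (\<integral>\<^sup>+c. indicator (section_prism v j) (?T' c) \<partial>?Q)"
    by (subst lborel, rule nn_integral_distr) measurable
  also have "\<dots> = (\<integral>\<^sup>+y. (\<integral>\<^sup>+c. indicator (section_prism v j) (?T' (c(v := y))) \<partial>?P) \<partial>lborel)"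
    using O(1,2) by (intro product_nn_integral_insert_rev) auto
  also have "\<dots> = (\<integral>\<^sup>+y. H * indicator {-1/2..1/2::real} y \<partial>lborel)"
  proof (rule nn_integral_cong)
    fix y :: real
    \<comment> \<open>Moving \<open>y *\<^sub>R v\<close> along the j-th axis back into the
      hyperplane gives w; it is orthogonal to v, so it acts as a translation of the coordinates in
      B.\<close>
    define w where "w = y *\<^sub>R v - (y / v $ j) *\<^sub>R axis j 1"
    have T': "?T' (c(v := y)) = y *\<^sub>R v + ?T c" for c
      using O(1,2) by (auto intro!: sum.cong)
    have vT': "v \<bullet> (y *\<^sub>R v + ?T c) = y" for c
      using vT by (simp add: inner_add_right vv)
    have w: "(\<Sum>b\<in>B. (w \<bullet> b) *\<^sub>R b) = w"
      using j by (intro O(6)) (simp add: w_def inner_diff_right vv inner_axis)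
    have "indicator (section_prism v j) (?T' (c(v := y)))
        = indicator {-1/2..1/2::real} y * (indicator unit_cube (?T (\<lambda>b\<in>B. c b + w \<bullet> b)) :: ennreal)" for c
    proof -
      have "?T (\<lambda>b\<in>B. c b + w \<bullet> b) = ?T c + w"
        by (simp add: scaleR_add_left sum.distrib w)
      also have "\<dots> = y *\<^sub>R v + ?T c - (y / v $ j) *\<^sub>R axis j 1"
        by (simp add: w_def algebra_simps)
      finally show ?thesis
        unfolding T' section_prism_def mem_Collect_eq vT' indicator_def by (auto simp: abs_le_iff vT')
    qed
    then have "(\<integral>\<^sup>+c. indicator (section_prism v j) (?T' (c(v := y))) \<partial>?P)
      = indicator {-1/2..1/2::real} y * (\<integral>\<^sup>+c. indicator unit_cube (?T (\<lambda>b\<in>B. c b + w \<bullet> b)) \<partial>?P)"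
      by (simp add: nn_integral_cmult)
    also have "(\<integral>\<^sup>+c. indicator unit_cube (?T (\<lambda>b\<in>B. c b + w \<bullet> b)) \<partial>?P)
      = (\<integral>\<^sup>+c. indicator unit_cube (?T c) \<partial>(distr ?P ?P (\<lambda>c. \<lambda>b\<in>B. c b + w \<bullet> b)))"
      by (subst nn_integral_distr) auto
    also have "\<dots> = (\<integral>\<^sup>+c. indicator (?T -` unit_cube \<inter> space ?P) c \<partial>?P)"
      unfolding distr_PiM_lborel_translate[OF O(1)] by (intro nn_integral_cong) (simp add: indicator_def)
    also have "\<dots> = H"
      unfolding H_def by (intro nn_integral_indicator measurable_sets[where A = borel]) auto
    finally show "(\<integral>\<^sup>+c. indicator (section_prism v j) (?T' (c(v := y))) \<partial>?P) = H * indicator {-1/2..1/2::real} y"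
      by (subst mult.commute)
  qed
  also have "\<dots> = H * emeasure lborel {-1/2..1/2::real}"
    by (rule nn_integral_cmult_indicator) simp
  also have "emeasure lborel {-1/2..1/2::real} = 1"
    by (subst emeasure_lborel_Icc) auto
  finally have "emeasure lborel (section_prism v j) = H" by simp
  with lhs show ?thesis by simp
qed

section \<open>Integrating out two coordinates\<close>

text \<open>For nonnegative a and b, the length of the intersection of two intervals of lengths a
  and b whose centres are z apart; for positive a and b, division by a b gives the density at z of a
  sum of uniform variables scaled by a and b. The four absolute values of linear forms are what
  \<open>mean_abs\<close> averages and what can be differentiated under the integral.\<close>

definition overlap :: "real \<Rightarrow> real \<Rightarrow> real \<Rightarrow> real" where
  "overlap a b z = (\<bar>z + (a + b) / 2\<bar> + \<bar>z - (a + b) / 2\<bar> - \<bar>z + (a - b) / 2\<bar> - \<bar>z - (a - b) / 2\<bar>) / 2"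

lemma overlap_eq:
  assumes "0 \<le> a" "0 \<le> b"
  shows "overlap a b w = max 0 (min (b / 2) (a / 2 - w) - max (- b / 2) (- a / 2 - w))"
proof -
  define p q where "p = a / 2" and "q = b / 2"
  have "0 \<le> p" "0 \<le> q" using assms by (auto simp: p_def q_def)
  then have "(\<bar>w + (p + q)\<bar> + \<bar>w - (p + q)\<bar> - \<bar>w + (p - q)\<bar> - \<bar>w - (p - q)\<bar>) / 2
      = max 0 (min q (p - w) - max (- q) (- p - w))"
    by (auto simp: max_def min_def abs_real_def)
  then show ?thesis
    by (simp add: overlap_def p_def q_def add_divide_distrib diff_divide_distrib)
qed

lemma overlap_nonneg: "0 \<le> a \<Longrightarrow> 0 \<le> b \<Longrightarrow> 0 \<le> overlap a b z"
  by (simp add: overlap_eq)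

lemma emeasure_abs_affine_le:
  fixes a w :: real
  assumes "0 < a"
  shows "emeasure lborel {y. \<bar>w + a * y\<bar> \<le> 1/2} = ennreal (1 / a)"
proof -
  have "{y. \<bar>w + a * y\<bar> \<le> 1/2} = {(-1/2 - w) / a..(1/2 - w) / a}"
  proof (intro set_eqI)
    fix y
    have "\<bar>w + a * y\<bar> \<le> 1/2 \<longleftrightarrow> -1/2 - w \<le> y * a \<and> y * a \<le> 1/2 - w"
      unfolding mult.commute[of y] by linarith
    then show "y \<in> {y. \<bar>w + a * y\<bar> \<le> 1/2} \<longleftrightarrow> y \<in> {(-1/2 - w) / a..(1/2 - w) / a}"
      using assms by (simp add: pos_divide_le_eq pos_le_divide_eq)
  qed
  also have "emeasure lborel \<dots> = ennreal (1 / a)"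
    using assms by (subst emeasure_lborel_Icc) (auto simp: divide_right_mono diff_divide_distrib)
  finally show ?thesis .
qed

lemma emeasure_overlap:
  fixes a b w :: real
  assumes "0 < a" "0 < b"
  shows "emeasure lborel {z. \<bar>z\<bar> \<le> 1/2 \<and> \<bar>w + b * z\<bar> \<le> a / 2} = ennreal (overlap a b w / b)"
proof -
  define l u where "l = max (- b / 2) (- a / 2 - w)" and "u = min (b / 2) (a / 2 - w)"
  have "{z. \<bar>z\<bar> \<le> 1/2 \<and> \<bar>w + b * z\<bar> \<le> a / 2} = {l / b..u / b}"
  proof (intro set_eqI iffI)
    fix z assume "z \<in> {z. \<bar>z\<bar> \<le> 1/2 \<and> \<bar>w + b * z\<bar> \<le> a / 2}"
    then have "\<bar>b * z\<bar> \<le> b / 2" "\<bar>w + b * z\<bar> \<le> a / 2"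
      using assms by (auto simp: abs_mult)
    then have "l \<le> b * z" "b * z \<le> u" unfolding l_def u_def by linarith+
    then show "z \<in> {l / b..u / b}" using assms by (simp add: field_simps)
  next
    fix z assume "z \<in> {l / b..u / b}"
    then have "l \<le> b * z" "b * z \<le> u" using assms by (auto simp: field_simps)
    then have "\<bar>b * z\<bar> \<le> b / 2" "\<bar>w + b * z\<bar> \<le> a / 2" unfolding l_def u_def by linarith+
    then show "z \<in> {z. \<bar>z\<bar> \<le> 1/2 \<and> \<bar>w + b * z\<bar> \<le> a / 2}" using assms by (auto simp: abs_mult)
  qed
  also have "emeasure lborel {l / b..u / b} = ennreal (max 0 (u - l) / b)"
    using assms by (auto simp: emeasure_lborel_Icc_eq divide_right_mono divide_le_cancel diff_divide_distrib max_def)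
  also have "max 0 (u - l) = overlap a b w"
    using assms unfolding l_def u_def by (simp add: overlap_eq)
  finally show ?thesis .
qed

text \<open>The shear makes the j-th cube condition free of the j-th coordinate, which survives only
  in the slab condition and contributes 1 / a. Integrating the k-th coordinate then contributes
  \<open>overlap\<close> divided by b.\<close>

lemma emeasure_section_prism_coordinates:
  fixes v :: "real ^ 'n"
  assumes j: "0 < v $ j" and k: "0 < v $ k" and jk: "j \<noteq> k"
  defines "I \<equiv> UNIV - {j, k}"
  shows "emeasure lborel (section_prism v j) =
    (\<integral>\<^sup>+x. indicator (PiE I (\<lambda>_. {-1/2..1/2})) x *
       ennreal (overlap (v $ j) (v $ k) (\<Sum>i\<in>I. v $ i * x i) / (v $ j * v $ k)) \<partial>PiM I (\<lambda>_. lborel))"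
proof -
  interpret product_sigma_finite "\<lambda>_::'n. lborel :: real measure" by standard
  let ?M = "\<lambda>I :: 'n set. PiM I (\<lambda>_. lborel :: real measure)"
  let ?T = "\<lambda>c. \<Sum>i\<in>UNIV. c i *\<^sub>R axis i 1 :: real ^ 'n"
  define a b S where "a = v $ j" and "b = v $ k" and "S = (\<lambda>x. \<Sum>i\<in>I. v $ i * x i)"
  have ab: "0 < a" "0 < b" using j k by (auto simp: a_def b_def)
  have U: "UNIV = insert j (insert k I)" and nI: "j \<notin> insert k I" "k \<notin> I" and fin: "finite I"
    using jk by (auto simp: I_def)
  have [measurable]: "?T \<in> measurable (?M UNIV) borel" by measurable
  have T: "?T c $ i = c i" for c i
    by (simp add: axis_def if_distrib sum.delta cong: if_cong)
  have lborel: "lborel = distr (?M UNIV) borel ?T"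
  proof (rule distr_PiM_orthonormal[symmetric])
    show "(\<Sum>i\<in>UNIV. (x \<bullet> axis i 1) *\<^sub>R axis i 1) = x" for x :: "real ^ 'n"
      unfolding vec_eq_iff T by (simp add: inner_axis)
  qed (auto simp: inner_axis_axis)
  define g where "g = (\<lambda>x. ennreal (1 / a) *
    (if (\<forall>i\<in>I. \<bar>x i\<bar> \<le> 1/2) \<and> \<bar>x k\<bar> \<le> 1/2 \<and> \<bar>S x + b * x k\<bar> \<le> a / 2 then 1 else 0))"
  have [measurable]: "S \<in> borel_measurable (?M (insert k I))"
    unfolding S_def by measurable
  have [measurable]: "g \<in> borel_measurable (?M (insert k I))"
    unfolding g_def using fin by measurable
  have S_upd: "S (x(i := y)) = S x" if "i \<notin> I" for x i y
    unfolding S_def using that by (intro sum.cong) auto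
  have "emeasure lborel (section_prism v j) = (\<integral>\<^sup>+x. indicator (section_prism v j) x \<partial>lborel)"
    by simp
  also have "\<dots> = (\<integral>\<^sup>+c. indicator (section_prism v j) (?T c) \<partial>?M UNIV)"
    by (subst lborel, rule nn_integral_distr) measurable
  also have "\<dots> = (\<integral>\<^sup>+c. indicator (section_prism v j) (?T c) \<partial>?M (insert j (insert k I)))"
    by (simp only: U)
  also have "\<dots> = (\<integral>\<^sup>+x. (\<integral>\<^sup>+y. indicator (section_prism v j) (?T (x(j := y))) \<partial>lborel) \<partial>?M (insert k I))"
    using nI fin by (intro product_nn_integral_insert) (auto simp: U[symmetric])
  also have "\<dots> = (\<integral>\<^sup>+x. g x \<partial>?M (insert k I))"
  proof (rule nn_integral_cong)
    fix x
    have vT: "v \<bullet> ?T (x(j := y)) = S x + b * x k + a * y" for y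
    proof -
      have "v \<bullet> ?T (x(j := y)) = (\<Sum>i\<in>insert j (insert k I). v $ i * (x(j := y)) i)"
        unfolding inner_vec_def T U[symmetric] by simp
      also have "\<dots> = a * y + (b * x k + S (x(j := y)))"
        using nI fin jk by (simp add: a_def b_def S_def)
      finally show ?thesis using nI S_upd[of j x y] by simp
    qed
    have iff: "?T (x(j := y)) \<in> section_prism v j \<longleftrightarrow>
        ((\<forall>i\<in>I. \<bar>x i\<bar> \<le> 1/2) \<and> \<bar>x k\<bar> \<le> 1/2 \<and> \<bar>S x + b * x k\<bar> \<le> a / 2) \<and> \<bar>(S x + b * x k) + a * y\<bar> \<le> 1/2" for y
    proof -
      let ?z = "?T (x(j := y)) - ((v \<bullet> ?T (x(j := y))) / v $ j) *\<^sub>R axis j 1"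
      \<comment> \<open>The shear replaces the j-th coordinate by the value that puts the point on
        the hyperplane, so y cancels.\<close>
      have z: "?z $ i = (if i = j then - ((S x + b * x k) / a) else x i)" for i
        unfolding vector_minus_component vector_scaleR_component T vT a_def[symmetric]
        using ab by (auto simp: axis_def field_simps)
      have "?z \<in> unit_cube \<longleftrightarrow> (\<forall>i\<in>insert j (insert k I). \<bar>?z $ i\<bar> \<le> 1/2)"
        unfolding unit_cube_iff U[symmetric] by simp
      also have "\<dots> \<longleftrightarrow> \<bar>S x + b * x k\<bar> / a \<le> 1/2 \<and> \<bar>x k\<bar> \<le> 1/2 \<and> (\<forall>i\<in>I. \<bar>x i\<bar> \<le> 1/2)"
        unfolding z using nI jk ab by (auto simp: abs_divide)
      also have "\<bar>S x + b * x k\<bar> / a \<le> 1/2 \<longleftrightarrow> \<bar>S x + b * x k\<bar> \<le> a / 2"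
        using ab by (simp add: field_simps)
      finally show ?thesis unfolding section_prism_def mem_Collect_eq vT by auto
    qed
    have "(\<integral>\<^sup>+y. indicator (section_prism v j) (?T (x(j := y))) \<partial>lborel)
      = (\<integral>\<^sup>+y. (if (\<forall>i\<in>I. \<bar>x i\<bar> \<le> 1/2) \<and> \<bar>x k\<bar> \<le> 1/2 \<and> \<bar>S x + b * x k\<bar> \<le> a / 2 then 1 else 0)
          * indicator {y. \<bar>(S x + b * x k) + a * y\<bar> \<le> 1/2} y \<partial>lborel)"
      unfolding indicator_def iff by (intro nn_integral_cong) auto
    also have "\<dots> = (if (\<forall>i\<in>I. \<bar>x i\<bar> \<le> 1/2) \<and> \<bar>x k\<bar> \<le> 1/2 \<and> \<bar>S x + b * x k\<bar> \<le> a / 2 then 1 else 0)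
          * emeasure lborel {y. \<bar>(S x + b * x k) + a * y\<bar> \<le> 1/2}"
      by (rule nn_integral_cmult_indicator) measurable
    also have "\<dots> = g x"
      unfolding emeasure_abs_affine_le[OF ab(1)] g_def by (rule mult.commute)
    finally show "(\<integral>\<^sup>+y. indicator (section_prism v j) (?T (x(j := y))) \<partial>lborel) = g x" .
  qed
  also have "\<dots> = (\<integral>\<^sup>+x. (\<integral>\<^sup>+z. g (x(k := z)) \<partial>lborel) \<partial>?M I)"
    using nI fin by (intro product_nn_integral_insert) auto
  also have "\<dots> = (\<integral>\<^sup>+x. indicator (PiE I (\<lambda>_. {-1/2..1/2})) x * ennreal (overlap a b (S x) / (a * b)) \<partial>?M I)"
  proof (rule nn_integral_cong)
    fix x assume x: "x \<in> space (?M I)"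
    have box: "x \<in> PiE I (\<lambda>_. {-1/2..1/2}) \<longleftrightarrow> (\<forall>i\<in>I. \<bar>x i\<bar> \<le> 1/2)"
      using x by (auto simp: space_PiM PiE_iff abs_le_iff minus_le_iff)
    have nk: "(\<forall>i\<in>I. \<bar>(x(k := z)) i\<bar> \<le> 1/2) \<longleftrightarrow> (\<forall>i\<in>I. \<bar>x i\<bar> \<le> 1/2)" for z
      using nI by auto
    have "(\<integral>\<^sup>+z. g (x(k := z)) \<partial>lborel) = (\<integral>\<^sup>+z. (ennreal (1 / a) * indicator (PiE I (\<lambda>_. {-1/2..1/2})) x) *
        indicator {z. \<bar>z\<bar> \<le> 1/2 \<and> \<bar>S x + b * z\<bar> \<le> a / 2} z \<partial>lborel)"
      unfolding g_def nk S_upd[OF nI(2)] indicator_def box by (intro nn_integral_cong) auto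
    also have "\<dots> = (ennreal (1 / a) * indicator (PiE I (\<lambda>_. {-1/2..1/2})) x) * ennreal (overlap a b (S x) / b)"
      unfolding emeasure_overlap[OF ab, symmetric] by (rule nn_integral_cmult_indicator) measurable
    also have "\<dots> = indicator (PiE I (\<lambda>_. {-1/2..1/2})) x * (ennreal (1 / a) * ennreal (overlap a b (S x) / b))"
      by (simp only: mult_ac)
    also have "ennreal (1 / a) * ennreal (overlap a b (S x) / b) = ennreal (overlap a b (S x) / (a * b))"
      using ab overlap_nonneg[of a b "S x"] by (subst ennreal_mult[symmetric]) auto
    finally show "(\<integral>\<^sup>+z. g (x(k := z)) \<partial>lborel)
      = indicator (PiE I (\<lambda>_. {-1/2..1/2})) x * ennreal (overlap a b (S x) / (a * b))" .
  qed
  finally show ?thesis unfolding a_def b_def S_def .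
qed

section \<open>The uniform probability measure on the cube and the section formula\<close>

definition centered_uniform :: "real measure" where
  "centered_uniform = density lborel (indicator {-1/2..1/2})"

lemma sets_centered_uniform [simp, measurable_cong]: "sets centered_uniform = sets borel"
  and space_centered_uniform [simp]: "space centered_uniform = UNIV"
  by (auto simp: centered_uniform_def)

lemma prob_space_centered_uniform: "prob_space centered_uniform"
proof
  have "emeasure centered_uniform (space centered_uniform) = (\<integral>\<^sup>+x. indicator {-1/2..1/2} x * indicator UNIV x \<partial>(lborel :: real measure))"
    unfolding centered_uniform_def by (subst emeasure_density) auto
  also have "\<dots> = emeasure lborel {-1/2..1/2::real}" by simp
  also have "\<dots> = 1" by (subst emeasure_lborel_Icc) auto
  finally show "emeasure centered_uniform (space centered_uniform) = 1" .
qed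

lemma PiM_centered_uniform:
  assumes I: "finite I"
  shows "PiM I (\<lambda>_. centered_uniform) = density (PiM I (\<lambda>_. lborel)) (indicator (PiE I (\<lambda>_. {-1/2..1/2})))"
    (is "_ = ?D")
proof -
  interpret L: product_sigma_finite "\<lambda>_. lborel :: real measure" by standard
  interpret prob_space centered_uniform by (rule prob_space_centered_uniform)
  interpret U: product_sigma_finite "\<lambda>_. centered_uniform" by standard
  show ?thesis
  proof (rule U.PiM_eqI[symmetric])
    fix A assume A: "\<And>i. i \<in> I \<Longrightarrow> A i \<in> sets centered_uniform"
    have "emeasure ?D (Pi\<^sub>E I A) = (\<integral>\<^sup>+x. indicator (PiE I (\<lambda>_. {-1/2..1/2})) x * indicator (Pi\<^sub>E I A) x \<partial>PiM I (\<lambda>_. lborel))"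
      using A I by (subst emeasure_density) (auto intro!: sets_PiM_I_finite)
    also have "\<dots> = (\<integral>\<^sup>+x. indicator (PiE I (\<lambda>i. {-1/2..1/2} \<inter> A i)) x \<partial>PiM I (\<lambda>_. lborel))"
      by (intro nn_integral_cong) (auto simp: indicator_def PiE_iff)
    also have "\<dots> = emeasure (PiM I (\<lambda>_. lborel)) (PiE I (\<lambda>i. {-1/2..1/2} \<inter> A i))"
      using A I by (intro nn_integral_indicator sets_PiM_I_finite) auto
    also have "\<dots> = (\<Prod>i\<in>I. emeasure lborel ({-1/2..1/2} \<inter> A i))"
      using A I by (subst L.emeasure_PiM) auto
    also have "\<dots> = (\<Prod>i\<in>I. emeasure centered_uniform (A i))"
    proof (intro prod.cong refl)
      fix i assume "i \<in> I"
      have "emeasure centered_uniform (A i) = (\<integral>\<^sup>+x. indicator {-1/2..1/2} x * indicator (A i) x \<partial>lborel)"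
        unfolding centered_uniform_def using A[OF \<open>i \<in> I\<close>] by (subst emeasure_density) auto
      also have "\<dots> = emeasure lborel ({-1/2..1/2} \<inter> A i)"
        using A[OF \<open>i \<in> I\<close>] by (simp add: indicator_inter_arith[symmetric])
      finally show "emeasure lborel ({-1/2..1/2} \<inter> A i) = emeasure centered_uniform (A i)" ..
    qed
    finally show "emeasure ?D (Pi\<^sub>E I A) = (\<Prod>i\<in>I. emeasure centered_uniform (A i))" .
  qed (use I in \<open>auto intro!: sets_PiM_cong\<close>)
qed

abbreviation cube_measure :: "'i set \<Rightarrow> ('i \<Rightarrow> real) measure" where
  "cube_measure I \<equiv> PiM I (\<lambda>_. centered_uniform)"

lemma prob_space_cube_measure: "prob_space (cube_measure I)"
  by (intro prob_space_PiM prob_space_centered_uniform)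

lemma AE_cube_measure:
  assumes "finite I"
  shows "AE x in cube_measure I. \<forall>i\<in>I. \<bar>x i\<bar> \<le> 1/2"
proof -
  have "AE x in PiM I (\<lambda>_. lborel). 0 < (indicator (PiE I (\<lambda>_. {-1/2..1/2})) x :: ennreal) \<longrightarrow> (\<forall>i\<in>I. \<bar>x i\<bar> \<le> (1/2::real))"
    by (intro AE_I2) (auto simp: indicator_def PiE_iff abs_le_iff minus_le_iff split: if_splits)
  then show ?thesis
    unfolding PiM_centered_uniform[OF assms]
    using assms by (subst AE_density) (auto intro!: borel_measurable_indicator sets_PiM_I_finite)
qed

text \<open>Only the two eliminated coordinates have to be positive, and the others are arbitrary.
  Thus the formula holds for all unit vectors near a given one, as differentiation requires.\<close>

lemma section_volume_eq:
  fixes v :: "real ^ 'n"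
  assumes v: "norm v = 1" and j: "0 < v $ j" and k: "0 < v $ k" and jk: "j \<noteq> k"
  defines "I \<equiv> UNIV - {j, k}"
  shows "section_volume v =
    (\<integral>x. overlap (v $ j) (v $ k) (\<Sum>i\<in>I. v $ i * x i) \<partial>cube_measure I) / (v $ j * v $ k)"
proof -
  let ?f = "\<lambda>x. overlap (v $ j) (v $ k) (\<Sum>i\<in>I. v $ i * x i) / (v $ j * v $ k)"
  have fin: "finite I" by simp
  have f0: "0 \<le> ?f x" for x
    using j k by (intro divide_nonneg_pos overlap_nonneg) auto
  have meas: "?f \<in> borel_measurable (PiM I (\<lambda>_. lborel))" "?f \<in> borel_measurable (cube_measure I)"
    unfolding overlap_def by measurable
  have box: "PiE I (\<lambda>_. {-1/2..1/2::real}) \<in> sets (PiM I (\<lambda>_. lborel))"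
    by (intro sets_PiM_I_finite) auto
  have "emeasure (subspace_lborel (orth_hyperplane v)) (central_section v) = emeasure lborel (section_prism v j)"
    using v j by (intro emeasure_section_prism) auto
  also have "\<dots> = (\<integral>\<^sup>+x. indicator (PiE I (\<lambda>_. {-1/2..1/2})) x * ennreal (?f x) \<partial>PiM I (\<lambda>_. lborel))"
    unfolding I_def by (rule emeasure_section_prism_coordinates[OF j k jk])
  also have "\<dots> = (\<integral>\<^sup>+x. ennreal (?f x) \<partial>cube_measure I)"
    unfolding PiM_centered_uniform[OF fin] using box meas by (subst nn_integral_density) auto
  finally have "section_volume v = enn2real (\<integral>\<^sup>+x. ennreal (?f x) \<partial>cube_measure I)"
    unfolding section_volume_def measure_def by simp
  also have "\<dots> = (\<integral>x. ?f x \<partial>cube_measure I)"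
    using f0 meas by (intro integral_eq_nn_integral[symmetric]) auto
  finally show ?thesis by simp
qed

text \<open>Off the null set where \<open>l x \<bullet> v\<close> vanishes, the absolute value is
  locally linear, so the remainder quotient is eventually 0 for each such x; it is bounded by 2 C
  throughout the range of the norm bound. Dominated convergence along sequences concludes.\<close>

lemma has_derivative_integral_abs_inner:
  fixes l :: "'x \<Rightarrow> 'a::euclidean_space"
  assumes "finite_measure M" and l [measurable]: "l \<in> borel_measurable M"
    and bound: "AE x in M. norm (l x) \<le> C"
    and nz: "AE x in M. l x \<bullet> v \<noteq> 0"
  shows "((\<lambda>w. \<integral>x. \<bar>l x \<bullet> w\<bar> \<partial>M) has_derivative (\<lambda>w. \<integral>x. sgn (l x \<bullet> v) * (l x \<bullet> w) \<partial>M)) (at v)"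
proof -
  interpret finite_measure M by fact
  have int_inner: "integrable M (\<lambda>x. g x * (l x \<bullet> w))"
    if [measurable]: "g \<in> borel_measurable M" and g: "\<And>x. \<bar>g x\<bar> \<le> 1" for g w
  proof (rule integrable_const_bound[where B = "C * norm w"])
    show "AE x in M. norm (g x * (l x \<bullet> w)) \<le> C * norm w"
      using bound
    proof eventually_elim
      case (elim x)
      have "norm (g x * (l x \<bullet> w)) \<le> 1 * (norm (l x) * norm w)"
        unfolding real_norm_def abs_mult using g Cauchy_Schwarz_ineq2 by (intro mult_mono) auto
      also have "\<dots> \<le> C * norm w" using elim by (simp add: mult_right_mono)
      finally show ?case .
    qed
  qed measurable
  have int_abs: "integrable M (\<lambda>x. \<bar>l x \<bullet> w\<bar>)" for w
    using int_inner[of "\<lambda>_. 1" w] by (simp add: integrable_abs)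
  have int_sgn: "integrable M (\<lambda>x. sgn (l x \<bullet> v) * (l x \<bullet> w))" for w
    by (intro int_inner) (auto simp: sgn_if)
  define D where "D = (\<lambda>w. \<integral>x. sgn (l x \<bullet> v) * (l x \<bullet> w) \<partial>M)"
  have lin: "linear D"
    unfolding D_def
    by (intro linearI) (simp_all add: inner_add_right distrib_left int_sgn mult.left_commute)
  define r where "r = (\<lambda>h x. (\<bar>l x \<bullet> (v + h)\<bar> - \<bar>l x \<bullet> v\<bar> - sgn (l x \<bullet> v) * (l x \<bullet> h)) / norm h)"
  have "((\<lambda>h. \<integral>x. r h x \<partial>M) \<longlongrightarrow> 0) (at 0)"
    unfolding tendsto_at_iff_sequentially comp_def
  proof (intro allI impI)
    fix X :: "nat \<Rightarrow> 'a" assume X: "\<forall>i. X i \<in> UNIV - {0}" "X \<longlonglongrightarrow> 0"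
    have "(\<lambda>n. \<integral>x. r (X n) x \<partial>M) \<longlonglongrightarrow> (\<integral>x. 0 \<partial>M)"
    proof (rule integral_dominated_convergence[where w = "\<lambda>_. 2 * C"])
      show "AE x in M. norm (r (X n) x) \<le> 2 * C" for n
        using bound
      proof eventually_elim
        case (elim x)
        have "\<bar>\<bar>p + q\<bar> - \<bar>p\<bar> - sgn p * q\<bar> \<le> 2 * \<bar>q\<bar>" for p q :: real
          by (auto simp: sgn_if)
        from this[of "l x \<bullet> v" "l x \<bullet> X n"]
        have "\<bar>\<bar>l x \<bullet> (v + X n)\<bar> - \<bar>l x \<bullet> v\<bar> - sgn (l x \<bullet> v) * (l x \<bullet> X n)\<bar> \<le> 2 * \<bar>l x \<bullet> X n\<bar>"
          by (simp add: inner_add_right)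
        also have "\<dots> \<le> 2 * (norm (l x) * norm (X n))"
          using Cauchy_Schwarz_ineq2 by simp
        also have "\<dots> \<le> 2 * (C * norm (X n))"
          using elim by (simp add: mult_right_mono)
        finally show ?case
          using X(1) by (simp add: r_def divide_le_eq mult_ac)
      qed
      show "AE x in M. (\<lambda>n. r (X n) x) \<longlonglongrightarrow> 0"
        using nz
      proof eventually_elim
        case (elim x)
        have "(\<lambda>n. \<bar>l x \<bullet> X n\<bar>) \<longlonglongrightarrow> \<bar>l x \<bullet> 0\<bar>"
          by (intro tendsto_intros X)
        then have "\<forall>\<^sub>F n in sequentially. \<bar>l x \<bullet> X n\<bar> < \<bar>l x \<bullet> v\<bar>"
          by (rule order_tendstoD) (use elim in simp)
        then have "\<forall>\<^sub>F n in sequentially. r (X n) x = 0"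
        proof eventually_elim
          case (elim n)
          have "\<bar>p + q\<bar> - \<bar>p\<bar> - sgn p * q = 0" if "\<bar>q\<bar> < \<bar>p\<bar>" for p q :: real
            using that by (auto simp: sgn_if)
          from this[OF elim] show ?case by (simp add: r_def inner_add_right)
        qed
        then show ?case by (rule tendsto_eventually)
      qed
    qed (auto simp: r_def)
    then show "(\<lambda>n. \<integral>x. r (X n) x \<partial>M) \<longlonglongrightarrow> 0" by simp
  qed
  moreover have "(\<integral>x. r h x \<partial>M)
      = ((\<integral>x. \<bar>l x \<bullet> (v + h)\<bar> \<partial>M) - (\<integral>x. \<bar>l x \<bullet> v\<bar> \<partial>M) - D h) / norm h" for h
    unfolding r_def D_def by (simp add: int_abs int_sgn)
  ultimately have "((\<lambda>h. ((\<integral>x. \<bar>l x \<bullet> (v + h)\<bar> \<partial>M) - (\<integral>x. \<bar>l x \<bullet> v\<bar> \<partial>M) - D h) / norm h) \<longlongrightarrow> 0) (at 0)"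
    by simp
  then have "((\<lambda>h. norm ((\<integral>x. \<bar>l x \<bullet> (v + h)\<bar> \<partial>M) - (\<integral>x. \<bar>l x \<bullet> v\<bar> \<partial>M) - D h) / norm h) \<longlongrightarrow> 0) (at 0)"
    using tendsto_norm_zero by fastforce
  then show ?thesis
    unfolding D_def[symmetric] has_derivative_at using lin by (simp add: linear_conv_bounded_linear)
qed

subsection \<open>Differentiability and symmetry\<close>

lemma integral_centered_uniform:
  fixes f :: "real \<Rightarrow> real"
  assumes "continuous_on UNIV f" and "(f has_integral y) {-1/2..1/2}"
  shows "(\<integral>t. f t \<partial>centered_uniform) = y"
proof -
  have [measurable]: "f \<in> borel_measurable borel"
    using assms(1) by (rule borel_measurable_continuous_onI)
  have "(\<integral>t. f t \<partial>centered_uniform) = (\<integral>t. indicator {-1/2..1/2} t *\<^sub>R f t \<partial>lborel)"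
  proof -
    have eq: "centered_uniform = density lborel (\<lambda>t. ennreal (indicator {-1/2..1/2} t))"
      unfolding centered_uniform_def by (intro arg_cong[where f = "density lborel"] ext) (simp add: indicator_def)
    show ?thesis by (subst eq, rule integral_density) auto
  qed
  also have "\<dots> = (LINT t:{-1/2..1/2}|lborel. f t)"
    by (simp add: set_lebesgue_integral_def)
  also have "\<dots> = integral {-1/2..1/2} f"
    using assms(1) by (intro set_borel_integral_eq_integral borel_integrable_atLeastAtMost') (auto intro: continuous_on_subset)
  also have "\<dots> = y" using assms(2) by blast
  finally show ?thesis .
qed

lemma AE_cube_measure_sum_le:
  assumes "finite I"
  shows "AE x in cube_measure I. \<bar>(\<Sum>i\<in>I. u i * x i) + c\<bar> \<le> (\<Sum>i\<in>I. \<bar>u i\<bar>) + \<bar>c\<bar>"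
  using AE_cube_measure[OF assms]
proof eventually_elim
  case (elim x)
  have "\<bar>(\<Sum>i\<in>I. u i * x i) + c\<bar> \<le> (\<Sum>i\<in>I. \<bar>u i * x i\<bar>) + \<bar>c\<bar>"
    by (intro order_trans[OF abs_triangle_ineq] add_right_mono sum_abs)
  also have "(\<Sum>i\<in>I. \<bar>u i * x i\<bar>) \<le> (\<Sum>i\<in>I. \<bar>u i\<bar>)"
  proof (rule sum_mono)
    fix i assume "i \<in> I"
    then have "\<bar>x i\<bar> \<le> 1" using elim by fastforce
    then show "\<bar>u i * x i\<bar> \<le> \<bar>u i\<bar>" by (simp add: abs_mult mult_left_le)
  qed
  finally show ?case by simp
qed

lemma integrable_cube_measure_continuous:
  fixes f :: "real \<Rightarrow> real"
  assumes I: "finite I" and f: "continuous_on UNIV f"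
  shows "integrable (cube_measure I) (\<lambda>x. f ((\<Sum>i\<in>I. u i * x i) + c))"
proof -
  interpret prob_space "cube_measure I" by (rule prob_space_cube_measure)
  define R where "R = (\<Sum>i\<in>I. \<bar>u i\<bar>) + \<bar>c\<bar>"
  have "compact (f ` {-R..R})"
    by (intro compact_continuous_image continuous_on_subset[OF f]) auto
  then obtain B where B: "\<And>y. y \<in> {-R..R} \<Longrightarrow> norm (f y) \<le> B"
    using compact_imp_bounded bounded_iff by (metis imageI)
  have [measurable]: "f \<in> borel_measurable borel"
    using f by (rule borel_measurable_continuous_onI)
  show ?thesis
  proof (rule integrable_const_bound[where B = B])
    show "AE x in cube_measure I. norm (f ((\<Sum>i\<in>I. u i * x i) + c)) \<le> B"
      using AE_cube_measure_sum_le[OF I, of u c] unfolding R_def[symmetric]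
      by eventually_elim (rule B, simp add: abs_le_iff)
  qed measurable
qed

text \<open>\<open>mean_abs m c\<close> is the mean of \<open>\<bar>U\<^sub>1 + \<dots> + U\<^sub>m + c\<bar>\<close> for independent uniform \<open>U\<^sub>i\<close>, by the case \<open>k = 0\<close>.\<close>

lemma integral_cube_measure_mean_abs:
  assumes "finite I"
  shows "(\<integral>x. mean_abs k ((\<Sum>i\<in>I. x i) + c) \<partial>cube_measure I) = mean_abs (k + card I) c"
  using assms
proof (induction I arbitrary: k rule: finite_induct)
  case empty
  show ?case by (simp add: PiM_empty lebesgue_integral_count_space_finite)
next
  case (insert i I)
  interpret prob_space centered_uniform by (rule prob_space_centered_uniform)
  interpret product_sigma_finite "\<lambda>_. centered_uniform" by standard
  have "(\<integral>x. mean_abs k ((\<Sum>i\<in>insert i I. x i) + c) \<partial>cube_measure (insert i I))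
      = (\<integral>x. (\<integral>t. mean_abs k ((\<Sum>i'\<in>insert i I. (x(i := t)) i') + c) \<partial>centered_uniform) \<partial>cube_measure I)"
  proof (rule product_integral_insert)
    show "integrable (cube_measure (insert i I)) (\<lambda>x. mean_abs k ((\<Sum>i\<in>insert i I. x i) + c))"
      using integrable_cube_measure_continuous[OF _ continuous_on_mean_abs, of "insert i I" k "\<lambda>_. 1" c]
        insert.hyps by (simp only: mult_1 finite_insert)
  qed (use insert.hyps in auto)
  also have "\<dots> = (\<integral>x. mean_abs (Suc k) ((\<Sum>i\<in>I. x i) + c) \<partial>cube_measure I)"
  proof (rule Bochner_Integration.integral_cong[OF refl])
    fix x
    have "(\<Sum>i'\<in>insert i I. (x(i := t)) i') = t + (\<Sum>i\<in>I. x i)" for t :: real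
    proof -
      have "(\<Sum>i'\<in>I. (x(i := t)) i') = (\<Sum>i\<in>I. x i)"
        using insert.hyps by (intro sum.cong) auto
      then show ?thesis unfolding sum.insert[OF insert.hyps] fun_upd_same by simp
    qed
    then have "(\<integral>t. mean_abs k ((\<Sum>i'\<in>insert i I. (x(i := t)) i') + c) \<partial>centered_uniform)
      = (\<integral>t. mean_abs k (((\<Sum>i\<in>I. x i) + c) + t) \<partial>centered_uniform)"
      by (simp add: add_ac)
    also have "\<dots> = mean_abs (Suc k) ((\<Sum>i\<in>I. x i) + c)"
      by (intro integral_centered_uniform mean_abs_Suc continuous_on_compose2[OF continuous_on_mean_abs[of UNIV]] continuous_intros) auto
    finally show "(\<integral>t. mean_abs k ((\<Sum>i'\<in>insert i I. (x(i := t)) i') + c) \<partial>centered_uniform)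
      = mean_abs (Suc k) ((\<Sum>i\<in>I. x i) + c)" .
  qed
  also have "\<dots> = mean_abs (k + card (insert i I)) c"
    using insert by simp
  finally show ?case .
qed

text \<open>With the other coordinates fixed, the equation determines the i-th one, so every slice
  is null.\<close>

lemma AE_cube_measure_affine_neq_0:
  assumes I: "finite I" and i: "i \<in> I" "u i \<noteq> 0"
  shows "AE x in cube_measure I. (\<Sum>i\<in>I. u i * x i) + c \<noteq> 0"
proof -
  interpret prob_space centered_uniform by (rule prob_space_centered_uniform)
  interpret product_sigma_finite "\<lambda>_. centered_uniform" by standard
  define J where "J = I - {i}"
  have J: "I = insert i J" "i \<notin> J" "finite J" using I i by (auto simp: J_def)
  let ?N = "{x \<in> space (cube_measure I). (\<Sum>i\<in>I. u i * x i) + c = 0}"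
  have [measurable]: "?N \<in> sets (cube_measure I)" by measurable
  have "emeasure (cube_measure I) ?N = (\<integral>\<^sup>+x. indicator ?N x \<partial>cube_measure (insert i J))"
    by (simp add: J(1)[symmetric])
  also have "\<dots> = (\<integral>\<^sup>+x. (\<integral>\<^sup>+t. indicator ?N (x(i := t)) \<partial>centered_uniform) \<partial>cube_measure J)"
    using J by (intro product_nn_integral_insert) (auto simp flip: J(1))
  also have "\<dots> = (\<integral>\<^sup>+x. 0 \<partial>cube_measure J)"
  proof (intro nn_integral_cong)
    fix x
    define p where "p = - ((\<Sum>i\<in>J. u i * x i) + c) / u i"
    have "indicator ?N (x(i := t)) \<le> (indicator {p} t :: ennreal)" for t
    proof -
      have "t = p" if "x(i := t) \<in> ?N"
      proof -
        have "(\<Sum>i'\<in>J. u i' * (x(i := t)) i') = (\<Sum>i\<in>J. u i * x i)"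
          using J by (intro sum.cong) auto
        then have "u i * t + (\<Sum>i\<in>J. u i * x i) + c = 0"
          using that J by simp
        then show ?thesis using i by (simp add: p_def field_simps add_eq_0_iff)
      qed
      then show ?thesis by (auto simp: indicator_def)
    qed
    then have "(\<integral>\<^sup>+t. indicator ?N (x(i := t)) \<partial>centered_uniform) \<le> (\<integral>\<^sup>+t. indicator {p} t \<partial>centered_uniform)"
      by (intro nn_integral_mono) auto
    also have "\<dots> = emeasure centered_uniform {p}" by simp
    also have "\<dots> = (\<integral>\<^sup>+t. indicator {-1/2..1/2} t * indicator {p} t \<partial>lborel)"
      unfolding centered_uniform_def by (subst emeasure_density) auto
    also have "\<dots> \<le> (\<integral>\<^sup>+t. indicator {p} t \<partial>lborel)"
      by (intro nn_integral_mono) (auto simp: indicator_def)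
    also have "\<dots> = 0" by simp
    finally show "(\<integral>\<^sup>+t. indicator ?N (x(i := t)) \<partial>centered_uniform) = 0" by simp
  qed
  finally have "emeasure (cube_measure I) ?N = 0" by simp
  then show ?thesis by (subst AE_iff_measurable[where N = ?N]) auto
qed

text \<open>An extension of the section volume off the sphere. The integral has degree 1 and the
  denominator degree 2; the factor \<open>norm v\<close> makes the function homogeneous of degree 0,
  so its derivative kills the radial direction.\<close>

definition section_function :: "'n \<Rightarrow> 'n \<Rightarrow> real ^ 'n \<Rightarrow> real" where
  "section_function j k v = norm v *
     (\<integral>x. overlap (v $ j) (v $ k) (\<Sum>i\<in>UNIV - {j, k}. v $ i * x i) \<partial>cube_measure (UNIV - {j, k})) / (v $ j * v $ k)"

text \<open>The third non-zero coordinate keeps the linear forms inside the absolute values non-zero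
  almost everywhere, so differentiation under the integral applies.\<close>

lemma section_function_differentiable:
  fixes v :: "real ^ 'n"
  assumes jk: "j \<noteq> k" and ik: "i \<noteq> j" "i \<noteq> k" and nz: "v $ j \<noteq> 0" "v $ k \<noteq> 0" "v $ i \<noteq> 0"
  shows "section_function j k differentiable (at v)"
proof -
  define I where "I = UNIV - {j, k}"
  have I: "finite I" "i \<in> I" using ik by (auto simp: I_def)
  interpret prob_space "cube_measure I" by (rule prob_space_cube_measure)
  \<comment> \<open>Representing vectors of the four linear forms in \<open>overlap\<close>: s and t
    are the signs with which the halved j-th and k-th entries are added.\<close>
  define l where "l = (\<lambda>s t x. (\<chi> i. if i = j then s / 2 else if i = k then t / 2 else x i) :: real ^ 'n)"
  have l_inner: "l s t x \<bullet> w = (\<Sum>i\<in>I. w $ i * x i) + (s * w $ j + t * w $ k) / 2" for s t x w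
  proof -
    have "l s t x \<bullet> w = (\<Sum>i\<in>insert j (insert k I). l s t x $ i * w $ i)"
      unfolding inner_vec_def by (intro sum.cong) (auto simp: I_def)
    also have "\<dots> = s / 2 * w $ j + (t / 2 * w $ k + (\<Sum>i\<in>I. l s t x $ i * w $ i))"
      using jk by (simp add: I_def l_def)
    also have "(\<Sum>i\<in>I. l s t x $ i * w $ i) = (\<Sum>i\<in>I. w $ i * x i)"
      by (intro sum.cong) (auto simp: I_def l_def)
    finally show ?thesis by (simp add: add_divide_distrib)
  qed
  have l_meas: "l s t \<in> borel_measurable (cube_measure I)" for s t
  proof (rule borel_measurable_euclidean_space[THEN iffD2], rule ballI)
    fix b :: "real ^ 'n" assume "b \<in> Basis"
    then obtain m where b: "b = axis m 1" by (auto simp: Basis_vec_def)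
    show "(\<lambda>x. l s t x \<bullet> b) \<in> borel_measurable (cube_measure I)"
    proof (cases "m \<in> I")
      case True
      have eq: "(\<lambda>x. l s t x \<bullet> b) = (\<lambda>x. x m)"
      proof (rule ext)
        fix x show "l s t x \<bullet> b = x m" using True unfolding b l_def I_def inner_axis by simp
      qed
      show ?thesis unfolding eq using True by measurable
    next
      case False
      then have eq: "(\<lambda>x. l s t x \<bullet> b) = (\<lambda>x. if m = j then s / 2 else t / 2)"
        unfolding b l_def I_def inner_axis by (intro ext) auto
      show ?thesis unfolding eq by (rule borel_measurable_const)
    qed
  qed
  have D: "(\<lambda>w. \<integral>x. \<bar>l s t x \<bullet> w\<bar> \<partial>cube_measure I) differentiable (at v)" if "\<bar>s\<bar> \<le> 1" "\<bar>t\<bar> \<le> 1" for s t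
    unfolding differentiable_def
  proof (intro exI, rule has_derivative_integral_abs_inner)
    show "finite_measure (cube_measure I)" by (rule finite_measure_axioms)
    show "l s t \<in> borel_measurable (cube_measure I)" by (rule l_meas)
    show "AE x in cube_measure I. norm (l s t x) \<le> (\<Sum>i\<in>(UNIV :: 'n set). 1/2)"
      using AE_cube_measure[OF I(1)]
    proof eventually_elim
      case (elim x)
      have "norm (l s t x) \<le> (\<Sum>i\<in>UNIV. \<bar>l s t x $ i\<bar>)" by (rule norm_le_l1_cart)
      also have "\<dots> \<le> (\<Sum>i\<in>(UNIV :: 'n set). 1/2)"
      proof (rule sum_mono)
        fix m
        consider "m = j" | "m = k" "m \<noteq> j" | "m \<in> I" "m \<noteq> j" "m \<noteq> k" by (auto simp: I_def)
        then show "\<bar>l s t x $ m\<bar> \<le> 1/2"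
        proof cases
          case 3
          then show ?thesis using elim unfolding l_def by simp
        qed (use that in \<open>simp_all add: l_def\<close>)
      qed
      finally show ?case .
    qed
    show "AE x in cube_measure I. l s t x \<bullet> v \<noteq> 0"
      unfolding l_inner by (rule AE_cube_measure_affine_neq_0[where u = "\<lambda>i. v $ i", OF I nz(3)])
  qed
  have int: "integrable (cube_measure I) (\<lambda>x. \<bar>l s t x \<bullet> w\<bar>)" for s t w
    unfolding l_inner
    by (rule integrable_cube_measure_continuous[OF I(1) continuous_on_rabs[OF continuous_on_id]])
  define G where "G = (\<lambda>w. norm w *
      (((\<integral>x. \<bar>l 1 1 x \<bullet> w\<bar> \<partial>cube_measure I) + (\<integral>x. \<bar>l (-1) (-1) x \<bullet> w\<bar> \<partial>cube_measure I)
       - (\<integral>x. \<bar>l 1 (-1) x \<bullet> w\<bar> \<partial>cube_measure I) - (\<integral>x. \<bar>l (-1) 1 x \<bullet> w\<bar> \<partial>cube_measure I)) / 2) / (w $ j * w $ k))"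
  have "section_function j k w = G w" for w
  proof -
    have ov: "overlap (w $ j) (w $ k) (\<Sum>i\<in>I. w $ i * x i)
        = (\<bar>l 1 1 x \<bullet> w\<bar> + \<bar>l (-1) (-1) x \<bullet> w\<bar> - \<bar>l 1 (-1) x \<bullet> w\<bar> - \<bar>l (-1) 1 x \<bullet> w\<bar>) / 2" for x
    proof -
      define z where "z = (\<Sum>i\<in>I. w $ i * x i)"
      have "l 1 1 x \<bullet> w = z + (w $ j + w $ k) / 2" "l (-1) (-1) x \<bullet> w = z - (w $ j + w $ k) / 2"
        "l 1 (-1) x \<bullet> w = z + (w $ j - w $ k) / 2" "l (-1) 1 x \<bullet> w = z - (w $ j - w $ k) / 2"
        unfolding l_inner z_def[symmetric] by (simp_all add: diff_divide_distrib add_divide_distrib)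
      then show ?thesis unfolding overlap_def z_def[symmetric] by (simp only:)
    qed
    show ?thesis
      unfolding section_function_def I_def[symmetric] ov G_def by (simp add: int)
  qed
  then have eq: "section_function j k = G" by blast
  have nth: "(\<lambda>w. w $ i) differentiable (at v)" for i
    by (rule bounded_linear_imp_differentiable[OF bounded_linear_vec_nth])
  have norm: "norm differentiable (at v)"
    using nz by (intro differentiable_norm_at) auto
  show ?thesis
    unfolding eq G_def
    by (rule differentiable_divide[OF differentiable_mult[OF norm differentiable_divide[OF
          differentiable_diff[OF differentiable_diff[OF differentiable_add[OF D D] D] D] differentiable_const]]
          differentiable_mult[OF nth nth]])
       (use nz in simp_all)
qed

section \<open>Homogeneity and symmetries of the section function\<close>

lemma section_function_scale:
  fixes v :: "real ^ 'n"
  assumes "0 < t"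
  shows "section_function j k (t *\<^sub>R v) = section_function j k v"
proof -
  have scale: "overlap (t * a) (t * b) (t * z) = t * overlap a b z" for a b z
  proof -
    have "\<bar>t * x + (t * y + t * y') / 2\<bar> = t * \<bar>x + (y + y') / 2\<bar>" for x y y'
      using assms abs_mult[of t "x + (y + y') / 2"] by (simp add: algebra_simps add_divide_distrib)
    from this[of z a b] this[of z "-a" "-b"] this[of z a "-b"] this[of z "-a" b] show ?thesis
      by (simp add: overlap_def algebra_simps diff_divide_distrib add_divide_distrib)
  qed
  have "(\<Sum>i\<in>S. (t *\<^sub>R v) $ i * x i) = t * (\<Sum>i\<in>S. v $ i * x i)" for S x
    by (simp add: sum_distrib_left mult.assoc)
  then show ?thesis
    using assms by (simp add: section_function_def scale)
qed

lemma section_function_swap: "section_function j k (\<chi> i. v $ Transposition.transpose j k i) = section_function j k v"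
proof (cases "j = k")
  case False
  have "(\<Sum>i\<in>UNIV - {j, k}. v $ Transposition.transpose j k i * x i) = (\<Sum>i\<in>UNIV - {j, k}. v $ i * x i)" for x
    by (intro sum.cong) (auto simp: transpose_apply_other)
  moreover have "norm (\<chi> i. v $ Transposition.transpose j k i) = norm v"
    unfolding norm_vec_def L2_set_def vec_lambda_beta
    by (subst sum.permute[OF permutes_swap_id, of j UNIV k]) (simp_all add: comp_def)
  moreover have "overlap a b z = overlap b a z" for a b z :: real
  proof -
    have e: "z + (b - a) / 2 = z - (a - b) / 2" "z - (b - a) / 2 = z + (a - b) / 2"
      by (simp_all add: diff_divide_distrib)
    show ?thesis unfolding overlap_def e add.commute[of b a] by simp
  qed
  ultimately show ?thesis
    by (simp add: section_function_def mult.commute)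
qed simp

text \<open>The permutation moves from the coefficients to the integration variables as its inverse,
  and a product of equal factors is invariant under reindexing.\<close>

lemma section_function_permute:
  assumes p: "p permutes (UNIV - {j, k})"
  shows "section_function j k (\<chi> i. v $ p i) = section_function j k v"
proof -
  define I where "I = UNIV - {j, k}"
  have p: "p permutes I" "p j = j" "p k = k" and finI: "finite I"
    using p by (auto simp: I_def permutes_not_in)
  have q: "inv p permutes I" by (rule permutes_inv[OF p(1)])
  have "p permutes UNIV" using p(1) by (rule permutes_subset) simp
  then have norm: "norm (\<chi> i. v $ p i) = norm v"
    unfolding norm_vec_def L2_set_def vec_lambda_beta
    by (subst (2) sum.permute) (simp_all add: comp_def)
  have sum: "(\<Sum>i\<in>I. v $ p i * x i) = (\<Sum>i\<in>I. v $ i * (\<lambda>i\<in>I. x (inv p i)) i)" for x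
  proof -
    have "(\<Sum>i\<in>I. v $ i * x (inv p i)) = (\<Sum>i\<in>I. v $ p i * x i)"
      by (subst sum.permute[OF p(1)]) (simp add: comp_def permutes_inverses(2)[OF p(1)])
    then show ?thesis by simp
  qed
  have "distr (cube_measure I) (cube_measure I) (\<lambda>x. \<lambda>i\<in>I. x (inv p i)) = cube_measure I"
    using distr_PiM_reindex[of I "\<lambda>_. centered_uniform" "inv p" I] prob_space_centered_uniform
      permutes_inj_on[OF q] permutes_in_image[OF q] by auto
  then have "(\<integral>x. f (\<lambda>i\<in>I. x (inv p i)) \<partial>cube_measure I) = (\<integral>x. f x \<partial>cube_measure I)"
    if "f \<in> borel_measurable (cube_measure I)" for f :: "_ \<Rightarrow> real"
    using integral_distr[of "\<lambda>x. \<lambda>i\<in>I. x (inv p i)" "cube_measure I" "cube_measure I" f] that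
      permutes_in_image[OF q] by (auto intro!: measurable_restrict)
  from this[of "\<lambda>x. overlap (v $ j) (v $ k) (\<Sum>i\<in>I. v $ i * x i)"]
  have "(\<integral>x. overlap (v $ j) (v $ k) (\<Sum>i\<in>I. v $ i * (\<lambda>i\<in>I. x (inv p i)) i) \<partial>cube_measure I)
      = (\<integral>x. overlap (v $ j) (v $ k) (\<Sum>i\<in>I. v $ i * x i) \<partial>cube_measure I)"
    unfolding overlap_def by measurable
  then show ?thesis
    unfolding section_function_def I_def[symmetric] norm vec_lambda_beta p(2,3) sum by simp
qed

subsection \<open>Existence of the critical direction\<close>

text \<open>For equal entries \<open>overlap\<close> collapses to a second difference with step s =
  u / q, scaled by q / 2. Evenness of \<open>mean_abs\<close> merges its outer terms, and the powers
  of q cancel by homogeneity.\<close>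

lemma section_function_two_values:
  fixes j k :: "'n::finite"
  assumes jk: "j \<noteq> k" and u: "0 < u" and q: "0 < q"
  defines "m \<equiv> CARD('n) - 2"
  shows "section_function j k (\<chi> i. if i = j \<or> i = k then u else q) =
     sqrt (2 * (u / q)\<^sup>2 + real m) * (mean_abs m (u / q) - mean_abs m 0) / (u / q)\<^sup>2"
proof -
  define I where "I = UNIV - {j, k}"
  have fin: "finite I" by simp
  have cardI: "card I = m" unfolding I_def m_def using jk by (simp add: card_Diff_subset)
  let ?v = "\<chi> i. if i = j \<or> i = k then u else q"
  have U: "UNIV = insert j (insert k I)" and nI: "j \<notin> insert k I" "k \<notin> I" "j \<notin> I"
    using jk by (auto simp: I_def)
  define s where "s = u / q"
  have s: "u = q * s" "0 < s" using u q by (auto simp: s_def)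
  have "(norm ?v)\<^sup>2 = (\<Sum>i\<in>insert j (insert k I). (?v $ i)\<^sup>2)"
    unfolding power2_norm_eq_inner inner_vec_def U[symmetric] by (simp add: power2_eq_square)
  also have "\<dots> = u\<^sup>2 + (u\<^sup>2 + (\<Sum>i\<in>I. (?v $ i)\<^sup>2))"
    using nI fin jk by simp
  also have "(\<Sum>i\<in>I. (?v $ i)\<^sup>2) = (\<Sum>i\<in>I. q\<^sup>2)"
    using nI by (intro sum.cong) auto
  finally have norm2: "(norm ?v)\<^sup>2 = q\<^sup>2 * (2 * s\<^sup>2 + real m)"
    by (simp add: cardI s power_mult_distrib algebra_simps)
  have "norm ?v = sqrt ((norm ?v)\<^sup>2)" by simp
  also have "\<dots> = q * sqrt (2 * s\<^sup>2 + real m)"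
    unfolding norm2 real_sqrt_mult using q by simp
  finally have norm: "norm ?v = q * sqrt (2 * s\<^sup>2 + real m)" .
  have ov: "overlap u u (\<Sum>i\<in>I. ?v $ i * x i) = q / 2 *
      (\<bar>(\<Sum>i\<in>I. x i) + s\<bar> + \<bar>(\<Sum>i\<in>I. x i) + (- s)\<bar> - 2 * \<bar>(\<Sum>i\<in>I. x i) + 0\<bar>)" for x
  proof -
    have "(\<Sum>i\<in>I. ?v $ i * x i) = (\<Sum>i\<in>I. q * x i)" using nI by (intro sum.cong) auto
    then have sum: "(\<Sum>i\<in>I. ?v $ i * x i) = q * (\<Sum>i\<in>I. x i)" by (simp add: sum_distrib_left)
    have "\<bar>q * y\<bar> = q * \<bar>y\<bar>" for y using q by (simp add: abs_mult)
    from this[of "(\<Sum>i\<in>I. x i) + s"] this[of "(\<Sum>i\<in>I. x i) - s"] this[of "(\<Sum>i\<in>I. x i)"]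
    show ?thesis
      unfolding overlap_def sum unfolding s(1) by (simp add: algebra_simps add_divide_distrib diff_divide_distrib)
  qed
  have mean: "(\<integral>x. \<bar>(\<Sum>i\<in>I. x i) + c\<bar> \<partial>cube_measure I) = mean_abs m c" for c
    using integral_cube_measure_mean_abs[OF fin, of 0 c] by (simp add: mean_abs_0 cardI)
  have int: "integrable (cube_measure I) (\<lambda>x. \<bar>(\<Sum>i\<in>I. x i) + c\<bar>)" for c
    using integrable_cube_measure_continuous[OF fin continuous_on_rabs[OF continuous_on_id], of "\<lambda>_. 1" c]
    by (simp only: mult_1)
  have "(\<integral>x. overlap u u (\<Sum>i\<in>I. ?v $ i * x i) \<partial>cube_measure I) = q / 2 * (mean_abs m s + mean_abs m (- s) - 2 * mean_abs m 0)"
    unfolding ov mean[symmetric]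
    by (subst integral_mult_right_zero)
       (simp only: Bochner_Integration.integral_add Bochner_Integration.integral_diff integral_mult_right_zero
         Bochner_Integration.integrable_add integrable_mult_right int)
  also have "\<dots> = q * (mean_abs m s - mean_abs m 0)"
    by (simp add: mean_abs_minus algebra_simps)
  finally have W: "(\<integral>x. overlap u u (\<Sum>i\<in>I. ?v $ i * x i) \<partial>cube_measure I) = q * (mean_abs m s - mean_abs m 0)" .
  have "section_function j k ?v = q * sqrt (2 * s\<^sup>2 + real m) * (q * (mean_abs m s - mean_abs m 0)) / (u * u)"
    unfolding section_function_def I_def[symmetric] norm using W by simp
  also have "\<dots> = sqrt (2 * s\<^sup>2 + real m) * (mean_abs m s - mean_abs m 0) / s\<^sup>2"
    using q s(2) by (simp add: s(1) power2_eq_square)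
  finally show ?thesis unfolding s_def .
qed

text \<open>Multiplying the numerator of the quotient rule by the square root R gives
  \<open>s * crit_eq m s\<close>; this is where \<open>crit_eq\<close> comes from.\<close>

lemma two_value_profile_deriv:
  assumes "0 < m" "0 < s" "crit_eq m s = 0"
  shows "((\<lambda>s. sqrt (2 * s\<^sup>2 + real m) * (mean_abs m s - mean_abs m 0) / s\<^sup>2) has_real_derivative 0) (at s)"
proof -
  define A B R where "A = central_diff m (spow m) s" and "B = mean_abs m s - mean_abs m 0"
    and "R = sqrt (2 * s\<^sup>2 + real m)"
  have pos: "0 < 2 * s\<^sup>2 + real m" using assms by (simp add: add_pos_nonneg)
  then have R: "0 < R" "R * R = 2 * s\<^sup>2 + real m" by (auto simp: R_def)
  have "((\<lambda>s. sqrt (2 * s\<^sup>2 + real m) * (mean_abs m s - mean_abs m 0) / s\<^sup>2) has_real_derivative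
      ((inverse R / 2 * (2 * (2 * s)) * B + A * R) * s\<^sup>2 - R * B * (2 * s)) / (s\<^sup>2 * s\<^sup>2)) (at s)"
    unfolding A_def B_def R_def using assms pos
    by (auto intro!: derivative_eq_intros mean_abs_has_real_derivative simp: mult_ac)
  also have "((inverse R / 2 * (2 * (2 * s)) * B + A * R) * s\<^sup>2 - R * B * (2 * s)) / (s\<^sup>2 * s\<^sup>2)
      = s * crit_eq m s / (R * (s\<^sup>2 * s\<^sup>2))"
  proof -
    have "R * ((inverse R / 2 * (2 * (2 * s)) * B + A * R) * s\<^sup>2 - R * B * (2 * s))
        = 2 * s * B * s\<^sup>2 + A * (R * R) * s\<^sup>2 - (R * R) * B * (2 * s)"
      using R(1) by (simp add: algebra_simps)
    also have "\<dots> = s * crit_eq m s"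
      unfolding R(2) crit_eq_def A_def[symmetric] B_def[symmetric] by (simp add: power2_eq_square algebra_simps)
    finally have "(inverse R / 2 * (2 * (2 * s)) * B + A * R) * s\<^sup>2 - R * B * (2 * s) = s * crit_eq m s / R"
      using R(1) by (simp add: nonzero_eq_divide_eq mult.commute)
    then show ?thesis by (simp only: divide_divide_eq_left)
  qed
  finally show ?thesis using assms by simp
qed

text \<open>The chain rule at a fixed point of the reindexing, combined with uniqueness of the
  derivative.\<close>

lemma derivative_of_invariant:
  fixes F :: "real ^ 'n \<Rightarrow> real"
  assumes D: "(F has_derivative D) (at v)" and inv: "\<And>w. F (\<chi> i. w $ p i) = F w" and v: "(\<chi> i. v $ p i) = v"
  shows "D (\<chi> i. w $ p i) = D w"
proof -
  let ?P = "\<lambda>w. (\<chi> i. w $ p i) :: real ^ 'n"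
  have "linear ?P" by (intro linearI) (simp_all add: vec_eq_iff)
  then have "(?P has_derivative ?P) (at v)"
    by (intro bounded_linear_imp_has_derivative) (simp add: linear_conv_bounded_linear)
  moreover have "(F has_derivative D) (at (?P v))" using D v by simp
  ultimately have "(F \<circ> ?P has_derivative D \<circ> ?P) (at v)" by (rule diff_chain_at)
  moreover have "F \<circ> ?P = F" using inv by (simp add: fun_eq_iff)
  ultimately have "D \<circ> ?P = D" using D has_derivative_unique by metis
  then show ?thesis by (metis comp_apply)
qed

theorem theorem1p2:
  assumes "CARD('n::finite) \<ge> 4"
  shows "\<exists>v :: real ^ 'n. v \<in> sphere 0 1 \<and> (\<forall>i. v $ i \<noteq> 0) \<and>
           critical_direction v \<and> \<not> diagonal_direction v"
proof -
  obtain T :: "'n set" where "card T = 2"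
    using obtain_subset_with_card_n[of 2 "UNIV :: 'n set"] assms by auto
  then obtain j k :: 'n where jk: "j \<noteq> k" by (auto simp: card_2_iff)
  define I where "I = UNIV - {j, k}"
  define m where "m = CARD('n) - 2"
  have m: "2 \<le> m" using assms by (simp add: m_def)
  have cardI: "card I = m" unfolding I_def m_def using jk by (simp add: card_Diff_subset)
  then obtain i0 where i0: "i0 \<in> I" using m by (cases "I = {}") auto
  have U: "UNIV = insert j (insert k I)" and nI: "j \<notin> insert k I" "k \<notin> I" "j \<notin> I" and fin: "finite I"
    using jk by (auto simp: I_def)
  obtain s where s: "1 < s" "crit_eq m s = 0" using crit_eq_root[OF m] .
  \<comment> \<open>Normalises the vector with entries s q at j, k and q elsewhere.\<close>
  define q where "q = 1 / sqrt (2 * s\<^sup>2 + real m)"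
  have pos: "0 < 2 * s\<^sup>2 + real m" using m by (simp add: add_nonneg_pos)
  then have q: "0 < q" by (simp add: q_def)
  \<comment> \<open>This curve moves the pair alone and leaves the sphere, which is harmless because
    the extended function is differentiable in the full space.\<close>
  define w where "w = (\<lambda>u. (\<chi> i. if i = j \<or> i = k then u else q) :: real ^ 'n)"
  define v where "v = w (s * q)"
  have v_nth: "v $ i = (if i = j \<or> i = k then s * q else q)" for i
    by (simp add: v_def w_def)
  have "(norm v)\<^sup>2 = (\<Sum>i\<in>insert j (insert k I). (v $ i)\<^sup>2)"
    unfolding power2_norm_eq_inner inner_vec_def U[symmetric] by (simp add: power2_eq_square)
  also have "\<dots> = (s * q)\<^sup>2 + ((s * q)\<^sup>2 + (\<Sum>i\<in>I. (v $ i)\<^sup>2))"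
    using nI fin jk by (simp add: v_nth)
  also have "(\<Sum>i\<in>I. (v $ i)\<^sup>2) = (\<Sum>i\<in>I. q\<^sup>2)"
    using nI by (intro sum.cong) (auto simp: v_nth)
  also have "(s * q)\<^sup>2 + ((s * q)\<^sup>2 + (\<Sum>i\<in>I. q\<^sup>2)) = q\<^sup>2 * (2 * s\<^sup>2 + real m)"
    by (simp add: cardI power_mult_distrib algebra_simps)
  also have "\<dots> = 1"
    using pos by (simp add: q_def power_divide)
  finally have norm_v: "norm v = 1"
    using norm_ge_zero[of v] by (simp add: power2_eq_1_iff)
  have nz: "v $ i \<noteq> 0" for i using q s(1) by (simp add: v_nth)
  let ?F = "section_function j k"
  have "?F differentiable (at v)"
    using i0 nz by (intro section_function_differentiable[OF jk, of i0]) (auto simp: I_def)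
  then obtain D where D: "(?F has_derivative D) (at v)"
    unfolding differentiable_def by blast
  then have lin: "linear D" by (rule has_derivative_linear)

  have D_I: "D (axis i 1) = D (axis i' 1)" if "i \<in> I" "i' \<in> I" for i i'
  proof -
    let ?p = "Transposition.transpose i i'"
    have p: "?p permutes (UNIV - {j, k})"
      using permutes_swap_id[of i I i'] that by (simp add: I_def)
    have "D (\<chi> l. axis i 1 $ ?p l) = D (axis i 1)"
      using nI that
      by (intro derivative_of_invariant[OF D section_function_permute[OF p]])
         (auto simp: vec_eq_iff v_nth Transposition.transpose_def)
    also have "(\<chi> l. axis i 1 $ ?p l) = axis i' 1"
      by (auto simp: vec_eq_iff axis_def Transposition.transpose_def)
    finally show ?thesis by simp
  qed
  have D_jk: "D (axis j 1) = D (axis k 1)"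
  proof -
    let ?p = "Transposition.transpose j k"
    have "D (\<chi> l. axis j 1 $ ?p l) = D (axis j 1)"
      by (intro derivative_of_invariant[OF D] section_function_swap)
         (auto simp: vec_eq_iff v_nth Transposition.transpose_def)
    also have "(\<chi> l. axis j 1 $ ?p l) = axis k 1"
      by (auto simp: vec_eq_iff axis_def Transposition.transpose_def)
    finally show ?thesis by simp
  qed
  \<comment> \<open>Euler's relation in degree 0: the function is constant along the ray through
    v.\<close>
  have D_v: "D v = 0"
  proof -
    have "((\<lambda>t. t *\<^sub>R v) has_derivative (\<lambda>t. t *\<^sub>R v)) (at (1::real))"
      by (auto intro!: derivative_eq_intros)
    moreover have "(?F has_derivative D) (at (1 *\<^sub>R v))" using D by simp
    ultimately have "(?F \<circ> (\<lambda>t. t *\<^sub>R v) has_derivative D \<circ> (\<lambda>t. t *\<^sub>R v)) (at (1::real))"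
      by (rule diff_chain_at)
    then have "((\<lambda>t. ?F v) has_derivative D \<circ> (\<lambda>t. t *\<^sub>R v)) (at (1::real))"
      by (rule has_derivative_transform_within_open[of _ _ _ UNIV "{0<..}"])
         (auto simp: section_function_scale)
    then have "D \<circ> (\<lambda>t. t *\<^sub>R v) = (\<lambda>t. 0)"
      using has_derivative_unique[OF _ has_derivative_const] by blast
    from fun_cong[OF this, of 1] show ?thesis by simp
  qed
  have D_pair: "D (axis j 1 + axis k 1) = 0"
  proof -
    have w_eq: "w u = w 0 + u *\<^sub>R (axis j 1 + axis k 1)" for u
      using jk by (auto simp: vec_eq_iff w_def axis_def)
    have "(w has_derivative (\<lambda>u. u *\<^sub>R (axis j 1 + axis k 1))) (at (s * q))"
      by (subst w_eq[abs_def]) (auto intro!: derivative_eq_intros)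
    moreover have "(?F has_derivative D) (at (w (s * q)))" using D by (simp add: v_def)
    ultimately have D1: "(?F \<circ> w has_derivative D \<circ> (\<lambda>u. u *\<^sub>R (axis j 1 + axis k 1))) (at (s * q))"
      by (rule diff_chain_at)
    define g where "g = (\<lambda>s. sqrt (2 * s\<^sup>2 + real m) * (mean_abs m s - mean_abs m 0) / s\<^sup>2)"
    have "(g has_real_derivative 0) (at (s * q / q))"
      unfolding g_def using two_value_profile_deriv[of m s] m s q by simp
    moreover have "((\<lambda>u. u / q) has_real_derivative 1 / q) (at (s * q))"
      using q by (auto intro!: derivative_eq_intros)
    ultimately have "((\<lambda>u. g (u / q)) has_real_derivative 0 * (1 / q)) (at (s * q))"
      by (rule DERIV_chain2)
    then have D2: "((\<lambda>u. g (u / q)) has_derivative (\<lambda>u. 0)) (at (s * q))"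
      by (simp add: has_field_derivative_def flip: lambda_zero)
    have g_eq: "g (u / q) = (?F \<circ> w) u" if "0 < u" for u
      unfolding g_def w_def comp_def m_def using section_function_two_values[OF jk that q] by simp
    have "(?F \<circ> w has_derivative (\<lambda>u. 0)) (at (s * q))"
      by (rule has_derivative_transform_within_open[OF D2, of "{0<..}"]) (use s q in \<open>auto simp: g_eq simp del: comp_apply\<close>)
    from has_derivative_unique[OF D1 this] have "D \<circ> (\<lambda>u. u *\<^sub>R (axis j 1 + axis k 1)) = (\<lambda>u. 0)" .
    from fun_cong[OF this, of 1] show ?thesis by simp
  qed
  have D_j: "D (axis j 1) = 0" "D (axis k 1) = 0"
    using D_pair D_jk by (auto simp: linear_add[OF lin])
  have D_sum: "D w = (\<Sum>i\<in>UNIV. w $ i * D (axis i 1))" for w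
  proof -
    have "D w = D (\<Sum>i\<in>UNIV. w $ i *\<^sub>R axis i 1)"
      using basis_expansion[of w] by (simp add: scalar_mult_eq_scaleR)
    then show ?thesis by (simp add: linear_sum[OF lin] linear_scale[OF lin])
  qed
  \<comment> \<open>By symmetry a single unknown remains, the common value of D on the axes of I.
    The radial equation \<open>D v = 0\<close> gives it the factor m q, so it vanishes.\<close>
  have "0 = (\<Sum>i\<in>insert j (insert k I). v $ i * D (axis i 1))"
    using D_sum[of v] D_v by (simp flip: U)
  also have "\<dots> = (\<Sum>i\<in>I. v $ i * D (axis i 1))"
    using nI fin jk D_j by simp
  also have "\<dots> = (\<Sum>i\<in>I. q * D (axis i0 1))"
  proof (rule sum.cong)
    fix i assume "i \<in> I"
    then show "v $ i * D (axis i 1) = q * D (axis i0 1)"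
      using D_I[of i i0] i0 by (auto simp: v_nth I_def)
  qed simp
  also have "\<dots> = real m * (q * D (axis i0 1))"
    by (simp add: cardI)
  finally have "D (axis i0 1) = 0" using m q by simp
  then have "D (axis i 1) = 0" for i
    using D_j D_I[OF _ i0, of i] by (cases "i \<in> I") (auto simp: I_def)
  then have D0: "D w = 0" for w by (subst D_sum) simp

  have "(section_volume has_derivative D) (at v within sphere 0 1)"
  \<comment> \<open>Within distance s q of v, the entries at j and k, both s q at v, stay positive;
    there the extended function agrees with the section volume on the sphere.\<close>
  proof (rule has_derivative_transform_within[where d = "s * q" and f = ?F])
    show "(?F has_derivative D) (at v within sphere 0 1)" using D by (rule has_derivative_at_withinI)
    show "0 < s * q" using s q by simp
    show "v \<in> sphere 0 1" using norm_v by simp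
    fix x :: "real ^ 'n" assume x: "x \<in> sphere 0 1" "dist x v < s * q"
    have "0 < x $ i" if "i = j \<or> i = k" for i
    proof -
      have "\<bar>(x - v) $ i\<bar> < s * q"
        using x(2) component_le_norm_cart[of "x - v" i] by (simp add: dist_norm)
      then show ?thesis using that by (auto simp: v_nth)
    qed
    then show "?F x = section_volume x"
      using section_volume_eq[of x j k] x jk by (simp add: section_function_def)
  qed
  then have "critical_direction v"
    unfolding critical_direction_def critical_point_on_sphere_def using norm_v D0 by auto
  moreover have "\<not> diagonal_direction v"
  proof
    assume "diagonal_direction v"
    then obtain d J e where e: "\<And>i. e i \<in> {-1, 1 :: real}"
      and eq: "sgn v = (1 / sqrt (real d)) *\<^sub>R (\<chi> i. if i \<in> J then e i else 0)"
      unfolding diagonal_direction_def k_diagonal_def by blast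
    have "sgn v = v" using norm_v by (simp add: sgn_div_norm)
    then have v: "v $ i = 1 / sqrt (real d) * (if i \<in> J then e i else 0)" for i
      using eq by (simp add: vec_eq_iff)
    \<comment> \<open>A diagonal direction without zero entries has entries of one modulus, which s
      > 1 excludes.\<close>
    have "\<bar>v $ i\<bar> = 1 / sqrt (real d)" for i
    proof -
      have "i \<in> J" using nz[of i] v[of i] by (auto split: if_splits)
      moreover have "\<bar>e i\<bar> = 1" using e[of i] by auto
      ultimately show ?thesis using v[of i] by (simp add: abs_mult)
    qed
    from this[of j] this[of i0] have "\<bar>v $ j\<bar> = \<bar>v $ i0\<bar>" by simp
    moreover have "v $ j = s * q" "v $ i0 = q" using i0 nI by (auto simp: v_nth)
    ultimately show False using s q by (simp add: abs_mult)
  qed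
  ultimately show ?thesis using norm_v nz by (intro exI[of _ v]) auto
qed

end
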